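(* Let $p\in\operatorname{Sym}\mathscr P\langle\mathbf q,\bar{\mathbf q}\rangle$ satisfy $\deg(p)=2d$. Then $p$ is a quaternionic sum of squares (QSOS) if and only if there exists a positive semidefinite quaternionic matrix $G$ such that $p=\mathcal W_d^*G\mathcal W_d$. If $p\in\operatorname{Sym}\mathbb R\langle\mathbf q,\bar{\mathbf q}\rangle$, then $G$ may be chosen real.
   Context: $\mathbb H$ is the skew field of quaternions. Fix $n\ge1$ and letters $q_1,\dots,q_n,\bar q_1,\dots,\bar q_n$. $\mathcal W$ is the set of words (including the empty word $1$) in these letters, where words with the same normal form are identified: any consecutive factor $q_i\bar q_i$ or $\bar q_iq_i$ is written $|q_i|^2$ and moved to the front, so each word is uniquely $\prod_i|q_i|^{2\alpha_i}\tilde w$ with $\tilde w$ containing no such factor. $|w|$ is the length; $w^*$ is obtained by reversing $w$ and exchanging $q_i\leftrightarrow\bar q_i$. $\mathbb R\langle\mathbf q,\bar{\mathbf q}\rangle$ is the real $*$-algebra of finite sums $\sum_wp_ww$, $p_w\in\mathbb R$, with $p^*=\sum p_ww^*$. $\mathbb H\langle\mathbf q,\bar{\mathbf q}\rangle$ is the real free product of $\mathbb H$ (involution: conjugation) and $\mathbb R\langle\mathbf q,\bar{\mathbf q}\rangle$ (quaternionic constants do not commute with letters). Inside it, $\mathcal L$ is the space of left-coefficient polynomials $\sum_wp_ww$ with $p_w\in\mathbb H$, and $\mathscr P\langle\mathbf q,\bar{\mathbf q}\rangle$ is the space of middle-coefficient polynomials $p=\sum_{a,b\in\mathcal W}a\,p_{a,b}\,b$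 (finite sums, $p_{a,b}\in\mathbb H$), with $p^*=\sum b^*\bar p_{a,b}a^*$ and $\deg(p)=\max\{|a|+|b|:p_{a,b}\ne0\}$. $\operatorname{Sym}$ denotes the subset of elements with $p=p^*$. $p\in\operatorname{Sym}\mathscr P\langle\mathbf q,\bar{\mathbf q}\rangle$ is a QSOS if $p=\sum_{i=1}^Np_i^*p_i$ for some $p_1,\dots,p_N\in\mathcal L$; when $p\in\operatorname{Sym}\mathbb R\langle\mathbf q,\bar{\mathbf q}\rangle$ one additionally requires each $p_i$ to have real coefficients. $\mathcal W_d$ is the column vector of all words of length at most $d$, and $\mathcal W_d^*G\mathcal W_d=\sum_{u,v}u^*G_{u,v}v$. A quaternionic matrix $G$ is positive semidefinite if it is Hermitian ($G=G^*$, conjugate transpose) and $\mathbf v^*G\mathbf v\ge0$ for every quaternionic vector $\mathbf v$. *)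

theory Defs
  imports Complex_Main "HOL-Library.Poly_Mapping"
begin

section \<open>Involutions\<close>

class star =
  fixes star :: "'a \<Rightarrow> 'a"  (\<open>(_\<^sup>\<star>)\<close> [1000] 1000)

text \<open>Monoids with an anti-automorphic involution.  They are written additively because the
  convolution product of \<^typ>\<open>'a \<Rightarrow>\<^sub>0 'b\<close> is taken along \<open>+\<close>; commutativity is not assumed.\<close>

class star_monoid = monoid_add + star +
  assumes star_plus_rev: "(x + y)\<^sup>\<star> = y\<^sup>\<star> + x\<^sup>\<star>"
    and star_plus_star: "(x\<^sup>\<star>)\<^sup>\<star> = x"
begin

lemma star_plus_eq_iff: "x\<^sup>\<star> = y \<longleftrightarrow> x = y\<^sup>\<star>"
  by (metis star_plus_star)

lemma star_plus_zero: "0\<^sup>\<star> = 0"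
proof -
  have "0 + 0\<^sup>\<star> = 0"
    by (metis add_0_right star_plus_rev star_plus_star)
  then show ?thesis by simp
qed

end

class real_star_algebra = real_algebra_1 + star +
  assumes star_add: "(x + y)\<^sup>\<star> = x\<^sup>\<star> + y\<^sup>\<star>"
    and star_mult: "(x * y)\<^sup>\<star> = y\<^sup>\<star> * x\<^sup>\<star>"
    and star_scaleR: "(r *\<^sub>R x)\<^sup>\<star> = r *\<^sub>R x\<^sup>\<star>"
    and star_star: "(x\<^sup>\<star>)\<^sup>\<star> = x"

lemma star_one: "(1 :: 'a :: real_star_algebra)\<^sup>\<star> = 1"
  by (metis mult.right_neutral mult_1 star_mult star_star)

lemma star_zero: "(0 :: 'a :: real_star_algebra)\<^sup>\<star> = 0"
  by (metis add_cancel_right_right star_add add_0)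

lemma star_of_real: "(of_real r :: 'a :: real_star_algebra)\<^sup>\<star> = of_real r"
  by (simp add: of_real_def star_scaleR star_one)

lemma star_sum: "(\<Sum>i\<in>A. f i)\<^sup>\<star> = (\<Sum>i\<in>A. (f i)\<^sup>\<star>)" for f :: "'b \<Rightarrow> 'a :: real_star_algebra"
  by (induction A rule: infinite_finite_induct) (auto simp: star_zero star_add)

instantiation real :: real_star_algebra
begin

definition star_real :: "real \<Rightarrow> real" where "star_real x = x"

instance by standard (simp_all add: star_real_def)

end


section \<open>Quaternions\<close>

datatype quat = Quat (qRe: real) (qIm1: real) (qIm2: real) (qIm3: real)

lemma quat_eq_iff: "x = y \<longleftrightarrow> qRe x = qRe y \<and> qIm1 x = qIm1 y \<and> qIm2 x = qIm2 y \<and> qIm3 x = qIm3 y"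
  by (auto intro: quat.expand)

instantiation quat :: real_algebra_1
begin

definition "0 = Quat 0 0 0 0"

definition "1 = Quat 1 0 0 0"

definition "x + y = Quat (qRe x + qRe y) (qIm1 x + qIm1 y) (qIm2 x + qIm2 y) (qIm3 x + qIm3 y)"

definition "- x = Quat (- qRe x) (- qIm1 x) (- qIm2 x) (- qIm3 x)"

definition "x - y = Quat (qRe x - qRe y) (qIm1 x - qIm1 y) (qIm2 x - qIm2 y) (qIm3 x - qIm3 y)"

definition "x * y = Quat
  (qRe x * qRe y - qIm1 x * qIm1 y - qIm2 x * qIm2 y - qIm3 x * qIm3 y)
  (qRe x * qIm1 y + qIm1 x * qRe y + qIm2 x * qIm3 y - qIm3 x * qIm2 y)
  (qRe x * qIm2 y - qIm1 x * qIm3 y + qIm2 x * qRe y + qIm3 x * qIm1 y)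
  (qRe x * qIm3 y + qIm1 x * qIm2 y - qIm2 x * qIm1 y + qIm3 x * qRe y)"

definition "r *\<^sub>R x = Quat (r * qRe x) (r * qIm1 x) (r * qIm2 x) (r * qIm3 x)"

lemmas quat_defs = zero_quat_def one_quat_def plus_quat_def uminus_quat_def minus_quat_def
  times_quat_def scaleR_quat_def

instance
  by standard (auto simp: quat_defs algebra_simps)

end

instantiation quat :: real_star_algebra
begin

definition "x\<^sup>\<star> = Quat (qRe x) (- qIm1 x) (- qIm2 x) (- qIm3 x)"

instance
  by standard (auto simp: quat_defs star_quat_def algebra_simps)

end

definition qnorm2 :: "quat \<Rightarrow> real" where
  "qnorm2 x = (qRe x)\<^sup>2 + (qIm1 x)\<^sup>2 + (qIm2 x)\<^sup>2 + (qIm3 x)\<^sup>2"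

lemma qnorm2_eq_0_iff: "qnorm2 x = 0 \<longleftrightarrow> x = 0"
  by (simp add: qnorm2_def quat_defs quat_eq_iff add_nonneg_eq_0_iff)

lemma star_mult_self_quat: "x\<^sup>\<star> * x = qnorm2 x *\<^sub>R 1" "x * x\<^sup>\<star> = qnorm2 x *\<^sub>R 1"
  by (simp_all add: qnorm2_def quat_defs star_quat_def quat_eq_iff algebra_simps power2_eq_square)

instantiation quat :: real_div_algebra
begin

definition "inverse x = inverse (qnorm2 x) *\<^sub>R x\<^sup>\<star>" for x :: quat

definition "x div y = x * inverse y" for x y :: quat

instance
proof
  fix x y :: quat
  show "inverse x * x = 1" if "x \<noteq> 0"
    using that by (simp add: inverse_quat_def star_mult_self_quat qnorm2_eq_0_iff)
  show "x * inverse x = 1" if "x \<noteq> 0"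
    using that by (simp add: inverse_quat_def star_mult_self_quat qnorm2_eq_0_iff)
  show "x div y = x * inverse y"
    by (simp add: divide_quat_def)
  show "inverse 0 = (0 :: quat)"
    by (simp add: inverse_quat_def star_zero)
qed

end


section \<open>The word monoid\<close>

datatype 'n letter = Q 'n | Qbar 'n

primrec bar :: "'n letter \<Rightarrow> 'n letter" where
  "bar (Q i) = Qbar i"
| "bar (Qbar i) = Q i"

primrec idx :: "'n letter \<Rightarrow> 'n" where
  "idx (Q i) = i"
| "idx (Qbar i) = i"

lemma bar_bar [simp]: "bar (bar x) = x"
  by (cases x) auto

lemma idx_bar [simp]: "idx (bar x) = idx x"
  by (cases x) auto

text \<open>One step of the rewriting to normal form: a consecutive factor \<open>q\<^sub>i \<cdot> bar q\<^sub>i\<close> or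
  \<open>bar q\<^sub>i \<cdot> q\<^sub>i\<close> is replaced by \<open>|q\<^sub>i|\<^sup>2\<close>, spelled \<open>q\<^sub>i \<cdot> bar q\<^sub>i\<close>, at the front of the word.
  Two words have the same normal form iff they are related by the generated equivalence.\<close>

inductive wstep :: "'n letter list \<Rightarrow> 'n letter list \<Rightarrow> bool" where
  "wstep (u @ [x, bar x] @ v) ([Q (idx x), Qbar (idx x)] @ u @ v)"

quotient_type 'n word = "'n letter list" / "equivclp wstep"
  by (rule equivp_evquivclp)

lemma equivclp_respects:
  assumes "\<And>x y. r x y \<Longrightarrow> equivclp s (f x) (f y)" "equivclp r x y"
  shows "equivclp s (f x) (f y)"
  using assms(2)
proof (induction rule: equivclp_induct)
  case (step y z)
  then show ?case by (meson assms(1) equivclp_sym equivclp_trans)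
qed simp

lemma wstep_factor:
  "equivclp wstep (u @ [x, bar x] @ v) ([Q (idx x), Qbar (idx x)] @ u @ v)"
  by (rule r_into_equivclp, rule wstep.intros)

lemma wstep_append_left: "wstep u v \<Longrightarrow> equivclp wstep (w @ u) (w @ v)"
proof (induction rule: wstep.induct)
  case (1 u x v)
  have "equivclp wstep (w @ u @ [x, bar x] @ v) ([Q (idx x), Qbar (idx x)] @ w @ u @ v)"
    using wstep_factor[of "w @ u" x v] by simp
  moreover have "equivclp wstep (w @ [Q (idx x), Qbar (idx x)] @ u @ v) ([Q (idx x), Qbar (idx x)] @ w @ u @ v)"
    using wstep_factor[of w "Q (idx x)" "u @ v"] by simp
  ultimately show ?case
    by (meson equivclp_sym equivclp_trans)
qed

lemma wstep_append_right: "wstep u v \<Longrightarrow> equivclp wstep (u @ w) (v @ w)"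
proof (induction rule: wstep.induct)
  case (1 u x v)
  show ?case using wstep_factor[of u x "v @ w"] by simp
qed

lemma wstep_rev_bar: "wstep u v \<Longrightarrow> equivclp wstep (rev (map bar u)) (rev (map bar v))"
proof (induction rule: wstep.induct)
  case (1 u x v)
  let ?u = "rev (map bar u)" and ?v = "rev (map bar v)"
  have "equivclp wstep (?v @ [x, bar x] @ ?u) ([Q (idx x), Qbar (idx x)] @ ?v @ ?u)"
    by (rule wstep_factor)
  moreover have "equivclp wstep ((?v @ ?u) @ [Q (idx x), Qbar (idx x)]) ([Q (idx x), Qbar (idx x)] @ ?v @ ?u)"
    using wstep_factor[of "?v @ ?u" "Q (idx x)" "[]"] by simp
  ultimately show ?case
    by simp (meson equivclp_sym equivclp_trans)
qed

lemma equivclp_wstep_append: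
  assumes "equivclp wstep u u'" "equivclp wstep v v'"
  shows "equivclp wstep (u @ v) (u' @ v')"
proof -
  have "equivclp wstep (u @ v) (u' @ v)"
    using equivclp_respects[of wstep wstep "\<lambda>u. u @ v"] assms(1) wstep_append_right by metis
  moreover have "equivclp wstep (u' @ v) (u' @ v')"
    using equivclp_respects[of wstep wstep "\<lambda>v. u' @ v"] assms(2) wstep_append_left by metis
  ultimately show ?thesis by (rule equivclp_trans)
qed

instantiation word :: (type) star_monoid
begin

lift_definition zero_word :: "'a word" is "[]" .

lift_definition plus_word :: "'a word \<Rightarrow> 'a word \<Rightarrow> 'a word" is "(@)"
  by (rule equivclp_wstep_append)

lift_definition star_word :: "'a word \<Rightarrow> 'a word" is "\<lambda>u. rev (map bar u)"
  by (rule equivclp_respects[of wstep]) (rule wstep_rev_bar)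

instance
  by standard (transfer; simp add: rev_map o_def)+

end

lift_definition wlength :: "'n word \<Rightarrow> nat" is length
proof -
  fix u v :: "'n letter list"
  assume "equivclp wstep u v"
  then show "length u = length v"
    by (induction rule: equivclp_induct) (auto elim: wstep.cases)
qed

lemma wlength_plus [simp]: "wlength (u + v) = wlength u + wlength v"
  by transfer simp

lemma wlength_star [simp]: "wlength (u\<^sup>\<star>) = wlength u"
  by transfer simp

definition words_upto :: "nat \<Rightarrow> 'n word set" where
  "words_upto d = {w. wlength w \<le> d}"

lemma finite_words_upto [simp]: "finite (words_upto d :: 'n::finite word set)"
proof -
  have "x \<in> range Q \<union> range Qbar" for x :: "'n letter"
    by (cases x) auto
  then have "(UNIV :: 'n letter set) = range Q \<union> range Qbar"
    by blast
  then have fin: "finite (UNIV :: 'n letter set)"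
    by (metis finite_UnI finite_imageI finite_class.finite_UNIV)
  let ?L = "{u :: 'n letter list. set u \<subseteq> UNIV \<and> length u \<le> d}"
  have "w \<in> abs_word ` ?L" if "w \<in> words_upto d" for w
  proof -
    obtain u where w: "w = abs_word u"
      using word.abs_induct[of "\<lambda>w. \<exists>u. w = abs_word u" w] by blast
    with that have "length u \<le> d"
      by (simp add: words_upto_def wlength.abs_eq)
    then have "u \<in> ?L" by simp
    then show ?thesis unfolding w by (rule imageI)
  qed
  then show ?thesis
    using finite_imageI[OF finite_lists_length_le[OF fin, of d], of abs_word]
    by (meson finite_subset subsetI)
qed


section \<open>Monoid algebras\<close>

instantiation poly_mapping :: (type, real_vector) real_vector
begin

lift_definition scaleR_poly_mapping :: "real \<Rightarrow> ('a \<Rightarrow>\<^sub>0 'b) \<Rightarrow> ('a \<Rightarrow>\<^sub>0 'b)"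
  is "\<lambda>r f k. r *\<^sub>R f k"
  by (rule finite_subset) auto

instance
  by standard (transfer; simp add: fun_eq_iff algebra_simps)+

end

lemma lookup_scaleR: "Poly_Mapping.lookup (r *\<^sub>R p) k = r *\<^sub>R Poly_Mapping.lookup p k"
  by transfer simp

lemma scaleR_single: "r *\<^sub>R Poly_Mapping.single k x = Poly_Mapping.single k (r *\<^sub>R x)"
  by transfer (auto simp: when_def)

lemma poly_mapping_eq_sum_single:
  "p = (\<Sum>k\<in>Poly_Mapping.keys p. Poly_Mapping.single k (Poly_Mapping.lookup p k))"
  for p :: "'a \<Rightarrow>\<^sub>0 'b::comm_monoid_add"
  by (rule poly_mapping_eqI)
    (auto simp: lookup_sum lookup_single when_def in_keys_iff)

lemma poly_mapping_single_induct [case_names zero add]: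
  fixes p :: "'a \<Rightarrow>\<^sub>0 'b::comm_monoid_add"
  assumes "P 0" and "\<And>k x p. P p \<Longrightarrow> P (Poly_Mapping.single k x + p)"
  shows "P p"
proof -
  have "P (\<Sum>k\<in>A. Poly_Mapping.single k (Poly_Mapping.lookup p k))" if "finite A" for A
    using that by induction (auto intro: assms)
  then have "P (\<Sum>k\<in>Poly_Mapping.keys p. Poly_Mapping.single k (Poly_Mapping.lookup p k))"
    by simp
  then show ?thesis
    by (subst poly_mapping_eq_sum_single)
qed

instance poly_mapping :: (monoid_add, real_algebra_1) real_algebra_1
proof
  fix r :: real and p q :: "'a \<Rightarrow>\<^sub>0 'b"
  show "r *\<^sub>R p * q = r *\<^sub>R (p * q)"
  proof (induction p rule: poly_mapping_single_induct)
    case (add k x p)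
    have "r *\<^sub>R Poly_Mapping.single k x * q = r *\<^sub>R (Poly_Mapping.single k x * q)"
      by (induction q rule: poly_mapping_single_induct)
        (simp_all add: algebra_simps scaleR_single mult_single)
    with add show ?case by (simp add: algebra_simps)
  qed simp
  show "p * r *\<^sub>R q = r *\<^sub>R (p * q)"
  proof (induction p rule: poly_mapping_single_induct)
    case (add k x p)
    have "Poly_Mapping.single k x * r *\<^sub>R q = r *\<^sub>R (Poly_Mapping.single k x * q)"
      by (induction q rule: poly_mapping_single_induct)
        (simp_all add: algebra_simps scaleR_single mult_single)
    with add show ?case by (simp add: algebra_simps)
  qed simp
qed

instantiation poly_mapping :: (star_monoid, real_star_algebra) real_star_algebra
begin

lift_definition star_poly_mapping :: "('a \<Rightarrow>\<^sub>0 'b) \<Rightarrow> ('a \<Rightarrow>\<^sub>0 'b)"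
  is "\<lambda>f k. (f (k\<^sup>\<star>))\<^sup>\<star>"
proof -
  fix f :: "'a \<Rightarrow> 'b" assume "finite {k. f k \<noteq> 0}"
  then have "finite (star ` {k. f k \<noteq> 0})" by simp
  moreover have "{k. (f (k\<^sup>\<star>))\<^sup>\<star> \<noteq> 0} \<subseteq> star ` {k. f k \<noteq> 0}"
    by (auto simp: image_iff star_zero) (metis star_plus_star star_zero)
  ultimately show "finite {k. (f (k\<^sup>\<star>))\<^sup>\<star> \<noteq> 0}"
    by (rule rev_finite_subset)
qed

lemma star_single: "(Poly_Mapping.single k x :: 'a \<Rightarrow>\<^sub>0 'b)\<^sup>\<star> = Poly_Mapping.single (k\<^sup>\<star>) (x\<^sup>\<star>)"
  by transfer (auto simp: when_def fun_eq_iff star_zero star_plus_eq_iff)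

lemma star_add_poly_mapping: "(p + q)\<^sup>\<star> = p\<^sup>\<star> + q\<^sup>\<star>" for p q :: "'a \<Rightarrow>\<^sub>0 'b"
  by transfer (simp add: star_add)

lemma star_zero_poly_mapping: "(0 :: 'a \<Rightarrow>\<^sub>0 'b)\<^sup>\<star> = 0"
  by transfer (simp add: star_zero)

instance
proof
  fix r :: real and p q :: "'a \<Rightarrow>\<^sub>0 'b"
  show "(p + q)\<^sup>\<star> = p\<^sup>\<star> + q\<^sup>\<star>" by (rule star_add_poly_mapping)
  show "(p * q)\<^sup>\<star> = q\<^sup>\<star> * p\<^sup>\<star>"
  proof (induction p rule: poly_mapping_single_induct)
    case (add k x p)
    have "(Poly_Mapping.single k x * q)\<^sup>\<star> = q\<^sup>\<star> * (Poly_Mapping.single k x)\<^sup>\<star>"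
      by (induction q rule: poly_mapping_single_induct)
        (simp_all add: algebra_simps star_add_poly_mapping star_zero_poly_mapping star_single
          mult_single star_mult star_plus_rev)
    with add show ?case by (simp add: algebra_simps star_add_poly_mapping)
  qed (simp add: star_zero_poly_mapping)
  show "(r *\<^sub>R p)\<^sup>\<star> = r *\<^sub>R p\<^sup>\<star>" by transfer (simp add: star_scaleR)
  show "(p\<^sup>\<star>)\<^sup>\<star> = p" by transfer (simp add: star_star star_plus_star)
qed

end


section \<open>Free product of real algebras\<close>

text \<open>The coproduct of unital real algebras: expressions over the two factors, modulo the least
  congruence that enforces the ring laws, makes both injections unital ring homomorphisms, and
  identifies the two copies of the reals.\<close>

datatype ('a, 'b) fp_expr =
  Left 'a
| Right 'b
| Plus "('a, 'b) fp_expr" "('a, 'b) fp_expr"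
| Times "('a, 'b) fp_expr" "('a, 'b) fp_expr"

inductive fp_eq ::
  "('a::real_algebra_1, 'b::real_algebra_1) fp_expr \<Rightarrow> ('a, 'b) fp_expr \<Rightarrow> bool"  (infix \<open>\<approx>\<close> 50)
where
  fp_refl: "s \<approx> s"
| fp_sym: "s \<approx> t \<Longrightarrow> t \<approx> s"
| fp_trans [trans]: "s \<approx> t \<Longrightarrow> t \<approx> u \<Longrightarrow> s \<approx> u"
| Plus_cong: "s \<approx> s' \<Longrightarrow> t \<approx> t' \<Longrightarrow> Plus s t \<approx> Plus s' t'"
| Times_cong: "s \<approx> s' \<Longrightarrow> t \<approx> t' \<Longrightarrow> Times s t \<approx> Times s' t'"
| Plus_assoc: "Plus (Plus s t) u \<approx> Plus s (Plus t u)"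
| Plus_commute: "Plus s t \<approx> Plus t s"
| Plus_zero: "Plus (Left 0) s \<approx> s"
| Plus_neg: "Plus (Times (Left (- 1)) s) s \<approx> Left 0"
| Times_assoc: "Times (Times s t) u \<approx> Times s (Times t u)"
| Times_one_left: "Times (Left 1) s \<approx> s"
| Times_one_right: "Times s (Left 1) \<approx> s"
| fp_distrib_left: "Times s (Plus t u) \<approx> Plus (Times s t) (Times s u)"
| fp_distrib_right: "Times (Plus s t) u \<approx> Plus (Times s u) (Times t u)"
| Left_plus: "Left (a + a') \<approx> Plus (Left a) (Left a')"
| Left_times: "Left (a * a') \<approx> Times (Left a) (Left a')"
| Right_plus: "Right (b + b') \<approx> Plus (Right b) (Right b')"
| Right_times: "Right (b * b') \<approx> Times (Right b) (Right b')"
| scalars: "Left (of_real r) \<approx> Right (of_real r)"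

quotient_type (overloaded) ('a, 'b) free_product =
  "('a::real_algebra_1, 'b::real_algebra_1) fp_expr" / fp_eq
proof (rule equivpI)
  show "reflp (fp_eq :: ('a, 'b) fp_expr \<Rightarrow> _)" by (rule reflpI) (rule fp_refl)
  show "symp (fp_eq :: ('a, 'b) fp_expr \<Rightarrow> _)" by (rule sympI) (rule fp_sym)
  show "transp (fp_eq :: ('a, 'b) fp_expr \<Rightarrow> _)" by (rule transpI) (rule fp_trans)
qed

lift_definition fp_left :: "'a \<Rightarrow> ('a::real_algebra_1, 'b::real_algebra_1) free_product" is Left .

lift_definition fp_right :: "'b \<Rightarrow> ('a::real_algebra_1, 'b::real_algebra_1) free_product" is Right .

text \<open>The quotient is not the zero ring: expressions act on bilinear forms on the two factors.\<close>

primrec fp_act :: "('a::real_algebra_1, 'b::real_algebra_1) fp_expr \<Rightarrow>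
    ('a \<Rightarrow> 'b \<Rightarrow> real) \<Rightarrow> ('a \<Rightarrow> 'b \<Rightarrow> real)" where
  "fp_act (Left a) F = (\<lambda>x y. F (x * a) y)"
| "fp_act (Right b) F = (\<lambda>x y. F x (y * b))"
| "fp_act (Plus s t) F = (\<lambda>x y. fp_act s F x y + fp_act t F x y)"
| "fp_act (Times s t) F = fp_act s (fp_act t F)"

definition bilin :: "('a::real_vector \<Rightarrow> 'b::real_vector \<Rightarrow> real) \<Rightarrow> bool" where
  "bilin F \<longleftrightarrow> (\<forall>y. linear (\<lambda>x. F x y)) \<and> (\<forall>x. linear (F x))"

lemma bilinD:
  assumes "bilin F"
  shows "F (x + x') y = F x y + F x' y" "F (r *\<^sub>R x) y = r * F x y"
    "F x (y + y') = F x y + F x y'" "F x (r *\<^sub>R y) = r * F x y"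
    "F 0 y = 0" "F x 0 = 0" "F (- x) y = - F x y"
proof -
  have l: "linear (\<lambda>x. F x y)" and r: "linear (F x)" for x y
    using assms by (simp_all add: bilin_def)
  show "F (x + x') y = F x y + F x' y" "F (r *\<^sub>R x) y = r * F x y" "F 0 y = 0"
    "F (- x) y = - F x y"
    using linear_add[OF l] linear_scale[OF l] linear_0[OF l] linear_neg[OF l] by simp_all
  show "F x (y + y') = F x y + F x y'" "F x (r *\<^sub>R y) = r * F x y" "F x 0 = 0"
    using linear_add[OF r] linear_scale[OF r] linear_0[OF r] by simp_all
qed

lemma bilin_fp_act: "bilin F \<Longrightarrow> bilin (fp_act s F)"
proof (induction s arbitrary: F)
  case (Plus s t)
  from Plus.IH(1)[OF Plus.prems] Plus.IH(2)[OF Plus.prems] show ?case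
    by (simp add: bilin_def linear_iff distrib_left)
qed (simp_all add: bilin_def linear_iff distrib_right)

lemma fp_act_plus: "fp_act s (\<lambda>x y. F x y + G x y) = (\<lambda>x y. fp_act s F x y + fp_act s G x y)"
proof (induction s arbitrary: F G)
  case (Times s t)
  show ?case by (simp only: fp_act.simps Times.IH)
qed (simp_all add: fun_eq_iff)

lemma fp_act_respects: "s \<approx> t \<Longrightarrow> bilin F \<Longrightarrow> fp_act s F = fp_act t F"
proof (induction arbitrary: F rule: fp_eq.induct)
  case (Plus_cong s s' t t')
  show ?case by (simp only: fp_act.simps Plus_cong.IH[OF Plus_cong.prems])
next
  case (Times_cong s s' t t')
  then show ?case by (simp add: bilin_fp_act)
next
  case (Plus_neg s)
  then show ?case
    by (simp add: fun_eq_iff bilinD(5)[OF Plus_neg] bilinD(7)[OF bilin_fp_act[OF Plus_neg]])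
next
  case (Plus_zero s)
  then show ?case by (simp add: bilinD(5))
next
  case (fp_distrib_left s t u)
  then show ?case by (simp only: fp_act.simps fp_act_plus)
next
  case (scalars r)
  then show ?case by (simp add: of_real_def bilinD(2,4))
qed (simp_all add: fun_eq_iff bilinD(1,3) mult.assoc distrib_left add.assoc add.commute)

lemma not_Left_0_eq_Left_1: "\<not> (Left 0 :: ('a::real_algebra_1, 'b::real_algebra_1) fp_expr) \<approx> Left 1"
proof
  assume eq: "(Left 0 :: ('a, 'b) fp_expr) \<approx> Left 1"
  have ex: "\<exists>f :: 'c \<Rightarrow> real. linear f \<and> f 1 = 1" for dummy :: "'c::real_algebra_1"
  proof -
    have "independent {1 :: 'c}" by simp
    from linear_independent_extend[OF this, of "\<lambda>_. 1 :: real"] show ?thesis by auto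
  qed
  obtain f :: "'a \<Rightarrow> real" where f: "linear f" "f 1 = 1" using ex by blast
  obtain g :: "'b \<Rightarrow> real" where g: "linear g" "g 1 = 1" using ex by blast
  have "bilin (\<lambda>x y. f x * g y)"
    using f(1) g(1) by (auto simp: bilin_def linear_iff algebra_simps)
  from fun_cong[OF fun_cong[OF fp_act_respects[OF eq this], of 1], of 1] f g show False
    by (simp add: linear_0)
qed

lemma Left_of_real_commute: "Times (Left (of_real r)) s \<approx> Times s (Left (of_real r))"
proof (induction s)
  case (Left a)
  have "of_real r * a = a * of_real r" by (simp add: of_real_def)
  then show ?case by (metis fp_eq.Left_times fp_sym fp_trans)
next
  case (Right b)
  have *: "of_real r * b = b * of_real r" by (simp add: of_real_def)
  have "Times (Left (of_real r)) (Right b) \<approx> Times (Right (of_real r)) (Right b)"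
    by (intro fp_eq.Times_cong fp_eq.scalars fp_refl)
  also have "\<dots> \<approx> Times (Right b) (Right (of_real r))"
    using * by (metis fp_eq.Right_times fp_sym fp_trans)
  also have "\<dots> \<approx> Times (Right b) (Left (of_real r))"
    by (intro fp_eq.Times_cong fp_sym[OF fp_eq.scalars] fp_refl)
  finally show ?case .
next
  case (Plus s t)
  let ?r = "Left (of_real r)"
  have "Times ?r (Plus s t) \<approx> Plus (Times ?r s) (Times ?r t)" by (rule fp_distrib_left)
  also have "\<dots> \<approx> Plus (Times s ?r) (Times t ?r)" by (intro fp_eq.Plus_cong Plus)
  also have "\<dots> \<approx> Times (Plus s t) ?r" by (rule fp_sym[OF fp_distrib_right])
  finally show ?case .
next
  case (Times s t)
  let ?r = "Left (of_real r)"
  have "Times ?r (Times s t) \<approx> Times (Times ?r s) t" by (rule fp_sym[OF fp_eq.Times_assoc])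
  also have "\<dots> \<approx> Times (Times s ?r) t" by (intro fp_eq.Times_cong Times fp_refl)
  also have "\<dots> \<approx> Times s (Times ?r t)" by (rule fp_eq.Times_assoc)
  also have "\<dots> \<approx> Times s (Times t ?r)" by (intro fp_eq.Times_cong Times fp_refl)
  also have "\<dots> \<approx> Times (Times s t) ?r" by (rule fp_sym[OF fp_eq.Times_assoc])
  finally show ?case .
qed

instantiation free_product :: (real_algebra_1, real_algebra_1) ring_1
begin

lift_definition zero_free_product :: "('a, 'b) free_product" is "Left 0" .

lift_definition one_free_product :: "('a, 'b) free_product" is "Left 1" .

lift_definition plus_free_product :: "('a, 'b) free_product \<Rightarrow> ('a, 'b) free_product \<Rightarrow> ('a, 'b) free_product"
  is Plus by (rule fp_eq.Plus_cong)

lift_definition times_free_product :: "('a, 'b) free_product \<Rightarrow> ('a, 'b) free_product \<Rightarrow> ('a, 'b) free_product"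
  is Times by (rule fp_eq.Times_cong)

lift_definition uminus_free_product :: "('a, 'b) free_product \<Rightarrow> ('a, 'b) free_product"
  is "Times (Left (- 1))" by (intro fp_eq.Times_cong fp_refl)

definition minus_free_product :: "('a, 'b) free_product \<Rightarrow> ('a, 'b) free_product \<Rightarrow> ('a, 'b) free_product"
  where "minus_free_product x y = x + - y"

instance
proof
  fix x y z :: "('a, 'b) free_product"
  show "x + y + z = x + (y + z)" by transfer (rule fp_eq.Plus_assoc)
  show "x + y = y + x" by transfer (rule fp_eq.Plus_commute)
  show "0 + x = x" by transfer (rule fp_eq.Plus_zero)
  show "- x + x = 0" by transfer (rule fp_eq.Plus_neg)
  show "x - y = x + - y" by (rule minus_free_product_def)
  show "x * y * z = x * (y * z)" by transfer (rule fp_eq.Times_assoc)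
  show "1 * x = x" by transfer (rule fp_eq.Times_one_left)
  show "x * 1 = x" by transfer (rule fp_eq.Times_one_right)
  show "x * (y + z) = x * y + x * z" by transfer (rule fp_distrib_left)
  show "(x + y) * z = x * z + y * z" by transfer (rule fp_distrib_right)
  show "(0 :: ('a, 'b) free_product) \<noteq> 1" by transfer (rule not_Left_0_eq_Left_1)
qed

end

lemma fp_left_hom:
  "fp_left (a + a') = fp_left a + fp_left a'" "fp_left (a * a') = fp_left a * fp_left a'"
  "fp_left 0 = 0" "fp_left 1 = 1"
  by (transfer, rule Left_plus) (transfer, rule Left_times, (transfer, rule fp_refl)+)

lemma fp_right_hom_plus: "fp_right (b + b') = fp_right b + fp_right b'"
  by transfer (rule fp_eq.Right_plus)

lemma fp_right_hom_times: "fp_right (b * b') = fp_right b * fp_right b'"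
  by transfer (rule fp_eq.Right_times)

lemma fp_left_of_real: "fp_left (of_real r) = fp_right (of_real r)"
  by transfer (rule fp_eq.scalars)

lemma fp_right_hom:
  "fp_right (b + b') = fp_right b + fp_right b'" "fp_right (b * b') = fp_right b * fp_right b'"
  "fp_right 0 = 0" "fp_right 1 = 1"
  using fp_left_of_real[of 0] fp_left_of_real[of 1]
  by (simp_all add: fp_right_hom_plus fp_right_hom_times fp_left_hom)

instantiation free_product :: (real_algebra_1, real_algebra_1) real_algebra_1
begin

definition scaleR_free_product :: "real \<Rightarrow> ('a, 'b) free_product \<Rightarrow> ('a, 'b) free_product"
  where "scaleR_free_product r x = fp_left (of_real r) * x"

lemma fp_left_of_real_commute:
  "fp_left (of_real r) * x = x * fp_left (of_real r)" for x :: "('a, 'b) free_product"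
  by transfer (rule Left_of_real_commute)

instance
proof
  fix r s :: real and x y :: "('a, 'b) free_product"
  show "r *\<^sub>R (x + y) = r *\<^sub>R x + r *\<^sub>R y"
    by (simp add: scaleR_free_product_def algebra_simps)
  show "(r + s) *\<^sub>R x = r *\<^sub>R x + s *\<^sub>R x"
    by (simp add: scaleR_free_product_def algebra_simps fp_left_hom)
  show "r *\<^sub>R s *\<^sub>R x = (r * s) *\<^sub>R x"
    by (simp add: scaleR_free_product_def mult.assoc fp_left_hom)
  show "1 *\<^sub>R x = x"
    by (simp add: scaleR_free_product_def fp_left_hom)
  show "r *\<^sub>R x * y = r *\<^sub>R (x * y)"
    by (simp add: scaleR_free_product_def mult.assoc)
  show "x * r *\<^sub>R y = r *\<^sub>R (x * y)"
    by (metis scaleR_free_product_def mult.assoc fp_left_of_real_commute)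
qed

end

lemma of_real_free_product: "of_real r = fp_left (of_real r)"
  by (simp add: of_real_def[where 'a = "('a, 'b) free_product"] scaleR_free_product_def)

lemma free_product_induct [case_names left right plus times]:
  assumes "\<And>a. P (fp_left a)" "\<And>b. P (fp_right b)"
    and "\<And>x y. P x \<Longrightarrow> P y \<Longrightarrow> P (x + y)" "\<And>x y. P x \<Longrightarrow> P y \<Longrightarrow> P (x * y)"
  shows "P x"
proof (induction x rule: free_product.abs_induct)
  case (1 s)
  show ?case
    by (induction s)
      (simp_all add: assms flip: plus_free_product.abs_eq times_free_product.abs_eq
        fp_left.abs_eq fp_right.abs_eq)
qed

lemma free_product_universal:
  fixes f :: "'a::real_algebra_1 \<Rightarrow> 'c::real_algebra_1" and g :: "'b::real_algebra_1 \<Rightarrow> 'c"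
  assumes f: "\<And>x y. f (x + y) = f x + f y" "\<And>x y. f (x * y) = f x * f y"
      "\<And>r. f (of_real r) = of_real r"
    and g: "\<And>x y. g (x + y) = g x + g y" "\<And>x y. g (x * y) = g x * g y"
      "\<And>r. g (of_real r) = of_real r"
  shows "\<exists>!h :: ('a, 'b) free_product \<Rightarrow> 'c.
    (\<forall>x y. h (x + y) = h x + h y) \<and> (\<forall>x y. h (x * y) = h x * h y) \<and>
    (\<forall>a. h (fp_left a) = f a) \<and> (\<forall>b. h (fp_right b) = g b)"
proof -
  define ev :: "('a, 'b) fp_expr \<Rightarrow> 'c" where
    "ev = rec_fp_expr f g (\<lambda>_ _ x y. x + y) (\<lambda>_ _ x y. x * y)"
  have ev: "ev (Left a) = f a" "ev (Right b) = g b" "ev (Plus s t) = ev s + ev t"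
    "ev (Times s t) = ev s * ev t" for a b s t
    by (simp_all add: ev_def)
  have f01: "f 0 = 0" "f 1 = 1" "f (- 1) = - 1"
    using f(3)[of 0] f(3)[of 1] f(3)[of "-1"] by simp_all
  have resp: "ev s = ev t" if "s \<approx> t" for s t
    using that by induction (simp_all add: ev f g f01 algebra_simps)
  define h where "h x = ev (rep_free_product x)" for x
  have abs: "h (abs_free_product s) = ev s" for s
    unfolding h_def by (rule resp) (rule rep_abs_rsp_left[OF Quotient3_free_product], rule fp_refl)
  have h: "h (x + y) = h x + h y" "h (x * y) = h x * h y" "h (fp_left a) = f a" "h (fp_right b) = g b"
    for x y a b
    by (induction x rule: free_product.abs_induct; induction y rule: free_product.abs_induct;
      simp add: abs ev plus_free_product.abs_eq times_free_product.abs_eq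
        fp_left.abs_eq fp_right.abs_eq)+
  show ?thesis
  proof (rule ex1I[of _ h], use h in simp)
    fix h'
    assume h': "(\<forall>x y. h' (x + y) = h' x + h' y) \<and> (\<forall>x y. h' (x * y) = h' x * h' y) \<and>
      (\<forall>a. h' (fp_left a) = f a) \<and> (\<forall>b. h' (fp_right b) = g b)"
    show "h' = h"
    proof
      fix x show "h' x = h x"
        by (induction x rule: free_product_induct) (simp_all add: h' h)
    qed
  qed
qed

primrec fp_star :: "('a::real_star_algebra, 'b::real_star_algebra) fp_expr \<Rightarrow> ('a, 'b) fp_expr" where
  "fp_star (Left a) = Left (a\<^sup>\<star>)"
| "fp_star (Right b) = Right (b\<^sup>\<star>)"
| "fp_star (Plus s t) = Plus (fp_star s) (fp_star t)"
| "fp_star (Times s t) = Times (fp_star t) (fp_star s)"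

lemma fp_star_respects: "s \<approx> t \<Longrightarrow> fp_star s \<approx> fp_star t"
proof (induction rule: fp_eq.induct)
  case (Plus_neg s)
  have m1: "(- 1 :: 'a)\<^sup>\<star> = - 1" using star_of_real[of "-1", where 'a = 'a] by simp
  have "Times (fp_star s) (Left (- 1)) \<approx> Times (Left (- 1)) (fp_star s)"
    using fp_sym[OF Left_of_real_commute[of "-1" "fp_star s"]] by simp
  then have "Plus (Times (fp_star s) (Left (- 1))) (fp_star s) \<approx> Left 0"
    by (meson fp_eq.Plus_cong fp_eq.Plus_neg fp_refl fp_trans)
  then show ?case by (simp add: m1 star_zero)
qed (auto simp: star_add star_mult star_zero star_one star_of_real
    intro: fp_refl fp_sym fp_trans fp_eq.Plus_cong fp_eq.Times_cong fp_eq.Plus_assoc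
      fp_eq.Plus_commute fp_eq.Plus_zero fp_eq.Times_assoc[THEN fp_sym] fp_eq.Times_one_left
      fp_eq.Times_one_right fp_distrib_left fp_distrib_right fp_eq.Left_plus fp_eq.Left_times
      fp_eq.Right_plus fp_eq.Right_times fp_eq.scalars)

instantiation free_product :: (real_star_algebra, real_star_algebra) real_star_algebra
begin

lift_definition star_free_product :: "('a, 'b) free_product \<Rightarrow> ('a, 'b) free_product" is fp_star
  by (rule fp_star_respects)

lemma star_free_product_simps:
  "(fp_left a :: ('a, 'b) free_product)\<^sup>\<star> = fp_left (a\<^sup>\<star>)"
  "(fp_right b :: ('a, 'b) free_product)\<^sup>\<star> = fp_right (b\<^sup>\<star>)"
  "(x + y)\<^sup>\<star> = x\<^sup>\<star> + y\<^sup>\<star>" "(x * y)\<^sup>\<star> = y\<^sup>\<star> * x\<^sup>\<star>" for x y :: "('a, 'b) free_product"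
  by (transfer; simp add: fp_refl)+

instance
proof
  fix r :: real and x y :: "('a, 'b) free_product"
  show "(x + y)\<^sup>\<star> = x\<^sup>\<star> + y\<^sup>\<star>" "(x * y)\<^sup>\<star> = y\<^sup>\<star> * x\<^sup>\<star>"
    by (rule star_free_product_simps)+
  show "(r *\<^sub>R x)\<^sup>\<star> = r *\<^sub>R x\<^sup>\<star>"
    by (simp add: scaleR_free_product_def star_free_product_simps star_of_real fp_left_of_real_commute)
  show "(x\<^sup>\<star>)\<^sup>\<star> = x"
    by (induction x rule: free_product_induct) (simp_all add: star_free_product_simps star_star)
qed

end


section \<open>Quaternionic polynomials\<close>

type_synonym 'n rpoly = "'n word \<Rightarrow>\<^sub>0 real"

type_synonym 'n qpoly = "(quat, 'n rpoly) free_product"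

definition const :: "quat \<Rightarrow> 'n qpoly" where
  "const a = fp_left a"

definition mon :: "'n word \<Rightarrow> 'n qpoly" where
  "mon w = fp_right (Poly_Mapping.single w 1)"

definition real_polys :: "'n qpoly set" where
  "real_polys = range fp_right"

definition left_poly :: "('n word \<Rightarrow>\<^sub>0 quat) \<Rightarrow> 'n qpoly" where
  "left_poly c = (\<Sum>w\<in>Poly_Mapping.keys c. const (Poly_Mapping.lookup c w) * mon w)"

definition left_polys :: "'n qpoly set" where
  "left_polys = range left_poly"

definition middle_poly :: "('n word \<times> 'n word \<Rightarrow>\<^sub>0 quat) \<Rightarrow> 'n qpoly" where
  "middle_poly c = (\<Sum>(a, b)\<in>Poly_Mapping.keys c. mon a * const (Poly_Mapping.lookup c (a, b)) * mon b)"

definition middle_polys :: "'n qpoly set" where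
  "middle_polys = range middle_poly"

text \<open>The coefficient family of a middle-coefficient polynomial is not unique, because real
  coefficients commute with words in the free product (\<open>a \<cdot> 1 \<cdot> b = ab \<cdot> 1 \<cdot> 1\<close>) and so may cancel.  The degree is
  therefore the least value of \<open>max {|a| + |b| : p\<^sub>a\<^sub>b \<noteq> 0}\<close> over all coefficient families;
  the zero polynomial has degree 0.\<close>

definition deg :: "'n qpoly \<Rightarrow> nat" where
  "deg p = (LEAST m. \<exists>c. p = middle_poly c \<and> (\<forall>(a, b)\<in>Poly_Mapping.keys c. wlength a + wlength b \<le> m))"

definition Sym :: "'a::star set \<Rightarrow> 'a set" where
  "Sym A = {p \<in> A. p\<^sup>\<star> = p}"

definition qsos :: "'n qpoly \<Rightarrow> bool" where
  "qsos p \<longleftrightarrow> (\<exists>ps. set ps \<subseteq> (if p \<in> Sym real_polys then real_polys else left_polys) \<and>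
    p = (\<Sum>f\<leftarrow>ps. f\<^sup>\<star> * f))"

text \<open>A matrix is a function of two indices; only its entries on \<open>I \<times> I\<close> are relevant.\<close>

definition psd :: "'i set \<Rightarrow> ('i \<Rightarrow> 'i \<Rightarrow> quat) \<Rightarrow> bool" where
  "psd I G \<longleftrightarrow> (\<forall>u\<in>I. \<forall>v\<in>I. G u v = (G v u)\<^sup>\<star>) \<and>
    (\<forall>x. \<exists>r\<ge>0. (\<Sum>u\<in>I. \<Sum>v\<in>I. (x u)\<^sup>\<star> * G u v * x v) = of_real r)"

definition gram :: "nat \<Rightarrow> ('n word \<Rightarrow> 'n word \<Rightarrow> quat) \<Rightarrow> 'n qpoly" where
  "gram d G = (\<Sum>u\<in>words_upto d. \<Sum>v\<in>words_upto d. mon (u\<^sup>\<star>) * const (G u v) * mon v)"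

lemma star_mon: "(mon w)\<^sup>\<star> = mon (w\<^sup>\<star>)"
  by (simp add: mon_def star_free_product_simps star_single star_real_def)

lemma star_const: "(const a)\<^sup>\<star> = const (a\<^sup>\<star>)"
  by (simp add: const_def star_free_product_simps)

lemma star_middle_poly:
  "(middle_poly c)\<^sup>\<star> = (\<Sum>(a, b)\<in>Poly_Mapping.keys c. mon (b\<^sup>\<star>) * const ((Poly_Mapping.lookup c (a, b))\<^sup>\<star>) * mon (a\<^sup>\<star>))"
  by (simp add: middle_poly_def star_sum star_mult star_mon star_const case_prod_unfold mult.assoc)

lemma fp_right_eq_sum:
  "(fp_right p :: 'n qpoly) = (\<Sum>w\<in>Poly_Mapping.keys p. const (of_real (Poly_Mapping.lookup p w)) * mon w)"
proof -
  have sum: "(fp_right (\<Sum>w\<in>A. f w) :: 'n qpoly) = (\<Sum>w\<in>A. fp_right (f w))" for f and A :: "'n word set"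
    by (induction A rule: infinite_finite_induct) (simp_all add: fp_right_hom)
  have "Poly_Mapping.single w r = of_real r * Poly_Mapping.single w 1" for w :: "'n word" and r :: real
    by (simp add: of_real_def scaleR_single)
  then have "(fp_right (Poly_Mapping.single w r) :: 'n qpoly) = const (of_real r) * mon w" for w r
    by (metis const_def mon_def fp_left_of_real fp_right_hom(2))
  moreover have "(fp_right p :: 'n qpoly) = fp_right (\<Sum>w\<in>Poly_Mapping.keys p. Poly_Mapping.single w (Poly_Mapping.lookup p w))"
    by (simp flip: poly_mapping_eq_sum_single)
  ultimately show ?thesis by (simp add: sum)
qed

end

theory Submission
  imports Defs "HOL-Library.Multiset"
begin

text \<open>A Gram matrix \<open>G\<close> is factored as \<open>G u v = (\<Sum>c. (c u)\<^sup>\<star> * c v)\<close> by repeated Schur complements,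
  which keep real entries real.  The other direction needs that the summands of a sum of squares
  of degree \<open>2d\<close> only involve words of length at most \<open>d\<close>.  Making the constants commute with the letters
  and taking real parts of coefficients gives well-defined functionals on the free product.  The word
  monoid is cancellative, since a word is determined by its letter indices (a multiset)
  and its freely reduced form.  Among the longest words that occur, let \<open>u\<close> be one whose vector of
  index multiplicities has maximal Euclidean norm.  By the parallelogram law, \<open>v\<^sup>\<star> w = u\<^sup>\<star> u\<close>
  forces \<open>v = w\<close>, so the real coefficient at \<open>u\<^sup>\<star> u\<close> is a sum of squared norms that includes
  those of the coefficients at \<open>u\<close> and cannot cancel.  For real \<open>p\<close> the same functionals allow
  \<open>G\<close> to be replaced by its real part.\<close>

section \<open>Cancellation in the word monoid\<close>

text \<open>Free reduction with \<open>bar\<close> as inverse, as in the free group. It forgets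
  exactly the factors |q_i|^2 that the normal form collects at the front.\<close>

primrec red :: "'n letter list \<Rightarrow> 'n letter list" where
  "red [] = []"
| "red (x # xs) = (case red xs of [] \<Rightarrow> [x] | y # ys \<Rightarrow> if y = bar x then ys else x # y # ys)"

lemma successively_red: "successively (\<lambda>x y. y \<noteq> bar x) (red u)"
proof (induction u)
  case (Cons x u)
  then show ?case
    by (cases "red u"; cases "tl (red u)") auto
qed simp

text \<open>The delicate case is \<open>red v\<close> starting with \<open>x\<close>:
  \<open>bar x\<close> deletes that letter and \<open>x\<close> restores it, provided that the next
  letter is not \<open>bar x\<close>. This is what \<open>successively_red\<close>
  guarantees.\<close>

lemma red_cancel: "red (x # bar x # v) = red v"
  using successively_red[of v]
  by (cases "red v"; cases "tl (red v)") auto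

lemma red_append_cong: "red v = red v' \<Longrightarrow> red (u @ v) = red (u @ v')"
  by (induction u) auto

lemma red_wstep: "wstep u v \<Longrightarrow> red u = red v"
proof (induction rule: wstep.induct)
  case (1 u x v)
  have "red (u @ [x, bar x] @ v) = red (u @ v)"
    using red_append_cong[OF red_cancel[of x v], of u] by simp
  moreover have "red ([Q (idx x), Qbar (idx x)] @ u @ v) = red (u @ v)"
    using red_cancel[of "Q (idx x)" "u @ v"] by simp
  ultimately show ?case by simp
qed

lemma red_rev_bar_append: "red (rev (map bar x) @ x @ u) = red u"
proof (induction x arbitrary: u)
  case (Cons a x)
  have "red (rev (map bar x) @ bar a # bar (bar a) # x @ u) = red (rev (map bar x) @ x @ u)"
    by (intro red_append_cong red_cancel)
  with Cons show ?case by simp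
qed simp

lift_definition wred :: "'n word \<Rightarrow> 'n letter list" is red
proof -
  fix u v :: "'n letter list"
  assume "equivclp wstep u v"
  then show "red u = red v"
    by (induction rule: equivclp_induct) (auto dest: red_wstep)
qed

text \<open>The complementary invariant to \<open>wred\<close>: a rewriting step moves a norm factor
  but keeps its letter indices, so the content still counts what free reduction deletes.\<close>

lift_definition wcontent :: "'n word \<Rightarrow> 'n multiset" is "\<lambda>u. mset (map idx u)"
proof -
  fix u v :: "'n letter list"
  assume "equivclp wstep u v"
  then show "mset (map idx u) = mset (map idx v)"
    by (induction rule: equivclp_induct) (auto elim!: wstep.cases)
qed

lemma wcontent_plus [simp]: "wcontent (u + v) = wcontent u + wcontent v"
  by transfer simp

lemma wcontent_zero [simp]: "wcontent 0 = {#}"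
  by transfer simp

lemma wcontent_star [simp]: "wcontent (u\<^sup>\<star>) = wcontent u"
  by transfer (simp add: rev_map o_def)

text \<open>Up to free reduction, star is inversion. Hence \<open>wred v\<close> can be recovered
  from \<open>u\<close> and \<open>u + v\<close>, which gives left cancellation.\<close>

lemma wred_star_plus: "wred (u\<^sup>\<star> + (u + v)) = wred v"
  by transfer (rule red_rev_bar_append)

section \<open>Central norm factors and the normal form\<close>

lift_definition norm2 :: "'n \<Rightarrow> 'n word" is "\<lambda>i. [Q i, Qbar i]" .

lemma wcontent_norm2 [simp]: "wcontent (norm2 i) = {#i, i#}"
  by transfer simp

lemma norm2_commute: "norm2 i + w = w + norm2 i"
proof transfer
  fix i :: 'a and w
  show "equivclp wstep ([Q i, Qbar i] @ w) (w @ [Q i, Qbar i])"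
    using equivclp_sym[OF wstep_factor[of w "Q i" "[]"]] by simp
qed

lemma abs_word_bar: "abs_word [x] + abs_word [bar x] = norm2 (idx x)"
proof -
  have "abs_word [x, bar x] = abs_word [Q (idx x), Qbar (idx x)]"
    using wstep_factor[of "[]" x "[]"] by (simp add: word.abs_eq_iff)
  then show ?thesis
    by (simp add: plus_word.abs_eq norm2.abs_eq)
qed

abbreviation norms :: "'n list \<Rightarrow> 'n word" where
  "norms is \<equiv> sum_list (map norm2 is)"

lemma norms_commute: "norms is + w = w + norms is"
proof (induction "is")
  case (Cons i "is")
  then show ?case by (metis (no_types) add.assoc list.simps(9) norm2_commute sum_list.Cons)
qed simp

lemma wcontent_norms: "wcontent (norms is) = mset is + mset is"
  by (induction "is") auto

lemma norms_cong: "mset is = mset js \<Longrightarrow> norms is = norms js"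
proof (induction "is" arbitrary: js)
  case (Cons i "is")
  then have "i \<in> set js"
    by (metis list.set_intros(1) mset_eq_setD)
  then obtain ks ls where js: "js = ks @ i # ls"
    by (meson split_list)
  then have "norms is = norms (ks @ ls)"
    using Cons.prems by (intro Cons.IH) simp
  then show ?case
    using norms_commute[of ks "norm2 i"] by (simp add: js flip: add.assoc)
qed simp

text \<open>Existence of the normal form: each cancellation made by \<open>red\<close> releases one
  factor \<open>norm2 i\<close>, which is central and can join the others at the front.\<close>

lemma abs_word_eq_norms_red: "\<exists>is. abs_word u = norms is + abs_word (red u)"
proof (induction u)
  case Nil
  show ?case by (rule exI[of _ "[]"]) simp
next
  case (Cons x u)
  then obtain "is" where "abs_word u = norms is + abs_word (red u)" by blast
  then have *: "abs_word (x # u) = norms is + (abs_word [x] + abs_word (red u))"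
    using norms_commute[of "is" "abs_word [x]"]
    by (metis add.assoc append_Cons append_Nil plus_word.abs_eq)
  show ?case
  proof (cases "\<exists>ys. red u = bar x # ys")
    case True
    then obtain ys where ys: "red u = bar x # ys" by blast
    have "abs_word [x] + abs_word (red u) = norm2 (idx x) + abs_word ys"
      by (metis ys abs_word_bar add.assoc append_Cons append_Nil plus_word.abs_eq)
    then have "abs_word (x # u) = norms (is @ [idx x]) + abs_word (red (x # u))"
      using * ys by (simp add: add.assoc)
    then show ?thesis by blast
  next
    case False
    then have "red (x # u) = [x] @ red u" by (auto split: list.split)
    then show ?thesis using * by (metis plus_word.abs_eq)
  qed
qed

text \<open>In the normal form, the content is that of the reduced word plus twice the multiset of
  norm indices. The two invariants therefore fix this multiset, and central factors may be
  reordered.\<close>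

lemma word_eqI:
  assumes "wcontent u = wcontent v" "wred u = wred v"
  shows "u = v"
proof -
  have nf: "\<exists>is. w = norms is + abs_word (wred w)" for w :: "'a word"
    by (induction w rule: word.abs_induct) (simp add: wred.abs_eq abs_word_eq_norms_red)
  obtain "is" js where *: "u = norms is + abs_word (wred u)" "v = norms js + abs_word (wred v)"
    using nf by blast
  have "mset is + mset is = mset js + mset js"
    using assms arg_cong[OF *(1), of wcontent] arg_cong[OF *(2), of wcontent]
    by (simp add: wcontent_norms)
  then have "2 * count (mset is) i = 2 * count (mset js) i" for i
    by (metis count_union mult_2)
  then have "mset is = mset js"
    by (intro multiset_eqI) simp
  then show ?thesis
    using * assms norms_cong by metis
qed

lemma word_add_left_cancel:
  fixes u v x :: "'n word"
  assumes "x + u = x + v"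
  shows "u = v"
proof (rule word_eqI)
  show "wcontent u = wcontent v"
    using arg_cong[OF assms, of wcontent] by simp
  show "wred u = wred v"
    using assms by (metis wred_star_plus)
qed

text \<open>The word u^* u reduces freely to the empty word, so it is a product of norms that
  remembers only the content of u. Distinct words of equal content thus have the same
  square.\<close>

lemma star_plus_self_cong: "wcontent u = wcontent v \<Longrightarrow> u\<^sup>\<star> + u = v\<^sup>\<star> + v"
  by (rule word_eqI) (use wred_star_plus[of u 0] wred_star_plus[of v 0] in simp_all)


section \<open>Letting the constants commute with the letters\<close>

lemma lookup_map_of_real:
  "Poly_Mapping.lookup (Poly_Mapping.map of_real p) k = (of_real (Poly_Mapping.lookup p k) :: 'b::real_algebra_1)"
  by (simp add: Poly_Mapping.map.rep_eq when_def)

lemma map_of_real_add: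
  "Poly_Mapping.map of_real (p + q) = (Poly_Mapping.map of_real p + Poly_Mapping.map of_real q :: 'a \<Rightarrow>\<^sub>0 'b::real_algebra_1)"
  by (rule poly_mapping_eqI) (simp add: lookup_map_of_real lookup_add)

lemma map_of_real_single:
  "Poly_Mapping.map of_real (Poly_Mapping.single k x) = (Poly_Mapping.single k (of_real x) :: 'a \<Rightarrow>\<^sub>0 'b::real_algebra_1)"
  by (rule poly_mapping_eqI) (simp add: lookup_map_of_real lookup_single when_def)

lemma map_of_real_zero:
  "Poly_Mapping.map of_real 0 = (0 :: 'a \<Rightarrow>\<^sub>0 'b::real_algebra_1)"
  by (rule poly_mapping_eqI) (simp add: lookup_map_of_real)

lemma map_of_real_mult:
  "Poly_Mapping.map of_real (p * q) = (Poly_Mapping.map of_real p * Poly_Mapping.map of_real q :: 'a::monoid_add \<Rightarrow>\<^sub>0 'b::real_algebra_1)"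
proof (induction p rule: poly_mapping_single_induct)
  case (add k x p)
  have "Poly_Mapping.map of_real (Poly_Mapping.single k x * q) =
      (Poly_Mapping.single k (of_real x) * Poly_Mapping.map of_real q :: 'a \<Rightarrow>\<^sub>0 'b)"
    by (induction q rule: poly_mapping_single_induct)
      (simp_all add: map_of_real_zero map_of_real_add map_of_real_single mult_single distrib_left)
  with add show ?case
    by (simp add: map_of_real_add map_of_real_single distrib_right)
qed (simp add: map_of_real_zero)

lemma of_real_poly_mapping:
  "(of_real r :: 'a::monoid_add \<Rightarrow>\<^sub>0 'b::real_algebra_1) = Poly_Mapping.single 0 (of_real r)"
  by (simp add: of_real_def scaleR_single flip: single_one)

text \<open>In the monoid algebra with quaternionic coefficients, constants commute with words. The
  universal property of the free product supplies the homomorphism, which sends a h b to the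
  coefficient h at the word ab.\<close>

lemma ex_central:
  "\<exists>h :: 'n qpoly \<Rightarrow> ('n word \<Rightarrow>\<^sub>0 quat).
    (\<forall>x y. h (x + y) = h x + h y) \<and> (\<forall>x y. h (x * y) = h x * h y) \<and>
    (\<forall>a. h (fp_left a) = Poly_Mapping.single 0 a) \<and> (\<forall>b. h (fp_right b) = Poly_Mapping.map of_real b)"
  by (rule ex1_implies_ex, rule free_product_universal)
    (simp_all add: single_add mult_single of_real_poly_mapping map_of_real_add map_of_real_mult map_of_real_single)

definition central :: "'n qpoly \<Rightarrow> ('n word \<Rightarrow>\<^sub>0 quat)" where
  "central = (SOME h. (\<forall>x y. h (x + y) = h x + h y) \<and> (\<forall>x y. h (x * y) = h x * h y) \<and>
    (\<forall>a. h (fp_left a) = Poly_Mapping.single 0 a) \<and> (\<forall>b. h (fp_right b) = Poly_Mapping.map of_real b))"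

lemma central_hom:
  fixes x y :: "'n qpoly"
  shows "central (x + y) = central x + central y" "central (x * y) = central x * central y"
    "central (const a :: 'n qpoly) = Poly_Mapping.single 0 a"
    "central (fp_right b :: 'n qpoly) = Poly_Mapping.map of_real b"
proof -
  note * = someI_ex[OF ex_central[where 'n = 'n], folded central_def]
  show "central (x + y) = central x + central y" using * by simp
  show "central (x * y) = central x * central y" using * by simp
  show "central (const a :: 'n qpoly) = Poly_Mapping.single 0 a" using * by (simp add: const_def)
  show "central (fp_right b :: 'n qpoly) = Poly_Mapping.map of_real b" using * by simp
qed

text \<open>Being defined through a homomorphism, it does not depend on the coefficient family
  chosen to represent \<open>p\<close>, although such families are not unique.\<close>

definition re_coeff :: "'n qpoly \<Rightarrow> 'n word \<Rightarrow> real" where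
  "re_coeff p w = qRe (Poly_Mapping.lookup (central p) w)"

lemma re_coeff_add: "re_coeff (p + q) w = re_coeff p w + re_coeff q w"
  by (simp add: re_coeff_def central_hom lookup_add plus_quat_def)

lemma re_coeff_zero: "re_coeff 0 w = 0"
  using re_coeff_add[of 0 0 w] by simp

lemma re_coeff_sum: "re_coeff (\<Sum>i\<in>A. f i) w = (\<Sum>i\<in>A. re_coeff (f i) w)"
  by (induction A rule: infinite_finite_induct) (simp_all add: re_coeff_zero re_coeff_add)

lemma re_coeff_sum_list: "re_coeff (\<Sum>x\<leftarrow>xs. f x) w = (\<Sum>x\<leftarrow>xs. re_coeff (f x) w)"
  by (induction xs) (simp_all add: re_coeff_zero re_coeff_add)

lemma re_coeff_monomial: "re_coeff (mon a * const h * mon b) w = (if a + b = w then qRe h else 0)"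
  by (simp add: re_coeff_def central_hom mon_def map_of_real_single mult_single lookup_single
      when_def zero_quat_def)

lemma qRe_of_real [simp]: "qRe (of_real r) = r"
  by (simp add: of_real_def quat_defs)

lemma re_coeff_fp_right: "re_coeff (fp_right r) w = Poly_Mapping.lookup r w"
  by (simp add: re_coeff_def central_hom lookup_map_of_real)


section \<open>Positive semidefinite quaternionic matrices\<close>

lemma star_mult_self_of_real: "x\<^sup>\<star> * x = of_real (qnorm2 x)" for x :: quat
  by (simp add: star_mult_self_quat of_real_def)

lemma qnorm2_nonneg: "qnorm2 x \<ge> 0"
  by (simp add: qnorm2_def)

lemma qnorm2_minus: "qnorm2 (- x) = qnorm2 x"
  by (simp add: qnorm2_def quat_defs)

lemma qnorm2_scaleR: "qnorm2 (t *\<^sub>R x) = t\<^sup>2 * qnorm2 x"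
  by (simp add: qnorm2_def scaleR_quat_def power_mult_distrib distrib_left)

lemma star_minus: "(- x)\<^sup>\<star> = - (x\<^sup>\<star>)" for x :: "'a::real_star_algebra"
  using star_scaleR[of "-1" x] by simp

lemma star_diff: "(x - y)\<^sup>\<star> = x\<^sup>\<star> - y\<^sup>\<star>" for x :: "'a::real_star_algebra"
  using star_add[of x "- y"] by (simp add: star_minus)

lemma psdD:
  assumes "psd I G"
  shows "u \<in> I \<Longrightarrow> v \<in> I \<Longrightarrow> (G u v)\<^sup>\<star> = G v u"
    and "\<exists>r\<ge>0. (\<Sum>u\<in>I. \<Sum>v\<in>I. (x u)\<^sup>\<star> * G u v * x v) = of_real r"
  using assms unfolding psd_def by metis+

lemma psd_zero: "psd I (\<lambda>_ _. 0)"
  unfolding psd_def by (auto simp: star_zero intro: exI[of _ 0])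

lemma psd_add:
  assumes "psd I G" "psd I H"
  shows "psd I (\<lambda>u v. G u v + H u v)"
  unfolding psd_def
proof (intro conjI ballI allI)
  fix u v assume "u \<in> I" "v \<in> I"
  then show "G u v + H u v = (G v u + H v u)\<^sup>\<star>"
    by (simp add: star_add psdD(1)[OF assms(1)] psdD(1)[OF assms(2)])
next
  fix x
  obtain r s where "r \<ge> 0" "(\<Sum>u\<in>I. \<Sum>v\<in>I. (x u)\<^sup>\<star> * G u v * x v) = of_real r"
      "s \<ge> 0" "(\<Sum>u\<in>I. \<Sum>v\<in>I. (x u)\<^sup>\<star> * H u v * x v) = of_real s"
    using psdD(2)[OF assms(1), of x] psdD(2)[OF assms(2), of x] by blast
  then have "r + s \<ge> 0 \<and> (\<Sum>u\<in>I. \<Sum>v\<in>I. (x u)\<^sup>\<star> * (G u v + H u v) * x v) = of_real (r + s)"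
    by (simp add: distrib_left distrib_right sum.distrib)
  then show "\<exists>r\<ge>0. (\<Sum>u\<in>I. \<Sum>v\<in>I. (x u)\<^sup>\<star> * (G u v + H u v) * x v) = of_real r" ..
qed

lemma psd_rank1: "psd I (\<lambda>u v. (c u)\<^sup>\<star> * c v)"
  unfolding psd_def
proof (intro conjI ballI allI)
  fix x :: "'a \<Rightarrow> quat"
  define s where "s = (\<Sum>v\<in>I. c v * x v)"
  have "(\<Sum>u\<in>I. \<Sum>v\<in>I. (x u)\<^sup>\<star> * ((c u)\<^sup>\<star> * c v) * x v) = s\<^sup>\<star> * s"
    by (simp add: s_def star_sum star_mult sum_product mult.assoc)
  then have "qnorm2 s \<ge> 0 \<and> (\<Sum>u\<in>I. \<Sum>v\<in>I. (x u)\<^sup>\<star> * ((c u)\<^sup>\<star> * c v) * x v) = of_real (qnorm2 s)"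
    by (simp only: star_mult_self_of_real qnorm2_nonneg simp_thms)
  then show "\<exists>r\<ge>0. (\<Sum>u\<in>I. \<Sum>v\<in>I. (x u)\<^sup>\<star> * ((c u)\<^sup>\<star> * c v) * x v) = of_real r" ..
qed (simp add: star_mult star_star)

lemma psd_gram_of_vectors: "psd I (\<lambda>u v. \<Sum>c\<leftarrow>cs. (c u)\<^sup>\<star> * c v)"
  by (induction cs) (simp_all add: psd_zero psd_add psd_rank1)

text \<open>The real part of a quaternion \<open>h\<close> is the average of \<open>g\<^sup>\<star> h g\<close> over \<open>g \<in> {1, i, j, k}\<close>.\<close>

lemma psd_real_part:
  assumes "psd I G"
  shows "psd I (\<lambda>u v. of_real (qRe (G u v)))"
  unfolding psd_def
proof (intro conjI ballI allI)
  fix u v assume "u \<in> I" "v \<in> I"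
  then have "qRe (G u v) = qRe (G v u)"
    using psdD(1)[OF assms] by (metis quat.sel(1) star_quat_def)
  then show "of_real (qRe (G u v)) = (of_real (qRe (G v u)) :: quat)\<^sup>\<star>"
    by (simp add: star_of_real)
next
  fix x :: "'a \<Rightarrow> quat"
  \<comment> \<open>Multiplying the test vector by \<open>g\<close> on the left puts the conjugated
    entry between \<open>x u\<close> and \<open>x v\<close>, while \<open>F g\<close> is still a
    value of the form of \<open>G\<close>.\<close>
  define F where "F g = (\<Sum>u\<in>I. \<Sum>v\<in>I. (g * x u)\<^sup>\<star> * G u v * (g * x v))" for g
  have "\<exists>r\<ge>0. F g = of_real r" for g
    unfolding F_def by (rule psdD(2)[OF assms])
  then obtain r where r: "\<And>g. r g \<ge> 0" "\<And>g. F g = of_real (r g)" by metis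
  define e where "e = Quat 1 0 0 0"
  define i where "i = Quat 0 1 0 0"
  define j where "j = Quat 0 0 1 0"
  define k where "k = Quat 0 0 0 1"
  have re: "of_real (qRe h) = (1/4) *\<^sub>R (e\<^sup>\<star> * h * e + i\<^sup>\<star> * h * i + j\<^sup>\<star> * h * j + k\<^sup>\<star> * h * k)" for h
    by (simp add: of_real_def quat_defs star_quat_def e_def i_def j_def k_def)
  have "(x u)\<^sup>\<star> * of_real (qRe (G u v)) * x v = (1/4) *\<^sub>R
      ((e * x u)\<^sup>\<star> * G u v * (e * x v) + (i * x u)\<^sup>\<star> * G u v * (i * x v) +
       (j * x u)\<^sup>\<star> * G u v * (j * x v) + (k * x u)\<^sup>\<star> * G u v * (k * x v))" for u v
    unfolding re by (simp add: star_mult distrib_left distrib_right mult.assoc scaleR_right_distrib)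
  then have "(\<Sum>u\<in>I. \<Sum>v\<in>I. (x u)\<^sup>\<star> * of_real (qRe (G u v)) * x v) = (1/4) *\<^sub>R (F e + F i + F j + F k)"
    by (simp only: F_def scaleR_sum_right sum.distrib scaleR_right_distrib)
  also have "\<dots> = of_real ((1/4) * (r e + r i + r j + r k))"
    by (simp only: r(2) scaleR_conv_of_real of_real_mult of_real_add)
  finally show "\<exists>r\<ge>0. (\<Sum>u\<in>I. \<Sum>v\<in>I. (x u)\<^sup>\<star> * of_real (qRe (G u v)) * x v) = of_real r"
    using r(1) by (intro exI[of _ "(1/4) * (r e + r i + r j + r k)"]) simp
qed

text \<open>Block expansion of the form along the pivot index \<open>a\<close>. By Hermitian
  symmetry the column through \<open>a\<close> contributes the star of the row contribution.\<close>

lemma sesquilinear_insert: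
  assumes "finite J" "a \<notin> J" "psd (insert a J) G" "G a a = of_real r"
  defines "s \<equiv> \<lambda>x :: 'a \<Rightarrow> quat. \<Sum>v\<in>J. G a v * x v"
  shows "(\<Sum>u\<in>insert a J. \<Sum>v\<in>insert a J. (x u)\<^sup>\<star> * G u v * x v) =
    of_real (r * qnorm2 (x a)) + (x a)\<^sup>\<star> * s x + (s x)\<^sup>\<star> * x a + (\<Sum>u\<in>J. \<Sum>v\<in>J. (x u)\<^sup>\<star> * G u v * x v)"
proof -
  have "(x a)\<^sup>\<star> * of_real r * x a = of_real (r * qnorm2 (x a))"
    by (simp add: of_real_def star_mult_self_quat)
  moreover have "(s x)\<^sup>\<star> * x a = (\<Sum>u\<in>J. (x u)\<^sup>\<star> * G u a * x a)"
    unfolding s_def star_sum sum_distrib_right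
    by (intro sum.cong refl) (simp add: star_mult psdD(1)[OF assms(3)])
  ultimately show ?thesis
    using assms(1,2,4) by (simp add: s_def sum.distrib sum_distrib_left mult.assoc)
qed

lemma psd_subset:
  assumes "psd I G" "J \<subseteq> I" "finite I"
  shows "psd J G"
  unfolding psd_def
proof (intro conjI ballI allI)
  fix x :: "'a \<Rightarrow> quat"
  define y where "y u = (if u \<in> J then x u else 0)" for u
  have "(\<Sum>u\<in>I. \<Sum>v\<in>I. (y u)\<^sup>\<star> * G u v * y v) = (\<Sum>u\<in>J. \<Sum>v\<in>J. (y u)\<^sup>\<star> * G u v * y v)"
  proof -
    have "(\<Sum>v\<in>I. (y u)\<^sup>\<star> * G u v * y v) = (\<Sum>v\<in>J. (y u)\<^sup>\<star> * G u v * y v)" for u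
      by (rule sum.mono_neutral_right) (use assms in \<open>auto simp: y_def\<close>)
    moreover have "(\<Sum>u\<in>I. \<Sum>v\<in>J. (y u)\<^sup>\<star> * G u v * y v) = (\<Sum>u\<in>J. \<Sum>v\<in>J. (y u)\<^sup>\<star> * G u v * y v)"
      by (rule sum.mono_neutral_right) (use assms in \<open>auto simp: y_def star_zero\<close>)
    ultimately show ?thesis by simp
  qed
  also have "\<dots> = (\<Sum>u\<in>J. \<Sum>v\<in>J. (x u)\<^sup>\<star> * G u v * x v)"
    by (simp add: y_def)
  finally show "\<exists>r\<ge>0. (\<Sum>u\<in>J. \<Sum>v\<in>J. (x u)\<^sup>\<star> * G u v * x v) = of_real r"
    using psdD(2)[OF assms(1), of y] by simp
next
  fix u v assume "u \<in> J" "v \<in> J"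
  then show "G u v = (G v u)\<^sup>\<star>" using psdD(1)[OF assms(1)] assms(2) by (metis subsetD)
qed

lemma psd_diag:
  assumes "psd I G" "a \<in> I" "finite I"
  obtains r where "r \<ge> 0" "G a a = of_real r"
proof -
  have "psd {a} G" using psd_subset[OF assms(1)] assms by simp
  from psdD(2)[OF this, of "\<lambda>_. 1"] that show ?thesis
    by (auto simp: star_one)
qed

text \<open>Testing the form on a vector with entry -t G_{a,v} at \<open>a\<close> and 1 at
  \<open>v\<close> gives g - 2 t N with N the squared norm of G_{a,v}. This is affine in t and
  nonnegative for all t, so N = 0.\<close>

lemma psd_zero_diag:
  assumes "psd I G" "a \<in> I" "v \<in> I" "finite I" "G a a = 0"
  shows "G a v = 0"
proof (cases "v = a")
  case False
  have p: "psd {a, v} G" using psd_subset[OF assms(1)] assms by simp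
  obtain g where g: "G v v = of_real g" using psd_diag[OF assms(1,3,4)] by blast
  define N where "N = qnorm2 (G a v)"
  have "2 * t * N \<le> g" for t
  proof -
    define x where "x u = (if u = a then - t *\<^sub>R G a v else 1)" for u
    have s: "(\<Sum>w\<in>{v}. G a w * x w) = G a v" using False by (simp add: x_def)
    have "(\<Sum>u\<in>{a, v}. \<Sum>w\<in>{a, v}. (x u)\<^sup>\<star> * G u w * x w) =
        of_real (0 * qnorm2 (x a)) + (x a)\<^sup>\<star> * G a v + (G a v)\<^sup>\<star> * x a + of_real g"
      using sesquilinear_insert[of "{v}" a G 0 x] p False assms(5) g
      unfolding s by (simp add: x_def star_one)
    also have "\<dots> = of_real (g - 2 * t * N)"
    proof -
      have "(x a)\<^sup>\<star> * G a v = of_real (- t * N)" "(G a v)\<^sup>\<star> * x a = of_real (- t * N)"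
        by (simp_all add: x_def star_minus star_scaleR star_mult_self_of_real N_def of_real_def)
      then show ?thesis
        by (simp only: of_real_add[symmetric]) (rule arg_cong[where f = of_real], simp)
    qed
    finally show ?thesis
      using psdD(2)[OF p, of x] by (metis diff_ge_0_iff_ge of_real_eq_iff)
  qed
  \<comment> \<open>For nonzero \<open>N\<close> this choice of \<open>t\<close> would give g + 1 <=
    g.\<close>
  from this[of "(g + 1) / (2 * N)"] have "N = 0"
    by (cases "N = 0") auto
  then show ?thesis by (simp add: N_def qnorm2_eq_0_iff)
qed (use assms in simp)

lemma psd_schur_complement:
  assumes "finite J" "a \<notin> J" "psd (insert a J) G" "G a a = of_real r" "r > 0"
  shows "psd J (\<lambda>u v. G u v - (1 / r) *\<^sub>R (G u a * G a v))"
  unfolding psd_def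
proof (intro conjI ballI allI)
  fix u v assume "u \<in> J" "v \<in> J"
  then show "G u v - (1 / r) *\<^sub>R (G u a * G a v) = (G v u - (1 / r) *\<^sub>R (G v a * G a u))\<^sup>\<star>"
    by (simp add: star_diff star_scaleR star_mult psdD(1)[OF assms(3)])
next
  fix x :: "'a \<Rightarrow> quat"
  define s where "s = (\<Sum>v\<in>J. G a v * x v)"
  \<comment> \<open>Completing the square: this entry at \<open>a\<close> minimizes the form of
    \<open>G\<close> with the entries on \<open>J\<close> fixed, and the minimum is the form of the
    Schur complement at \<open>x\<close>.\<close>
  define y where "y = x(a := - ((1 / r) *\<^sub>R s))"
  have yx: "y u = x u" if "u \<in> J" for u using that assms(2) by (auto simp: y_def)
  have ss: "s\<^sup>\<star> * s = (\<Sum>u\<in>J. \<Sum>v\<in>J. (x u)\<^sup>\<star> * (G u a * G a v) * x v)"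
  proof -
    have "s\<^sup>\<star> = (\<Sum>u\<in>J. (x u)\<^sup>\<star> * G u a)"
      unfolding s_def star_sum by (intro sum.cong refl) (simp add: star_mult psdD(1)[OF assms(3)])
    then show ?thesis by (simp add: s_def sum_product mult.assoc)
  qed
  have "(\<Sum>u\<in>insert a J. \<Sum>v\<in>insert a J. (y u)\<^sup>\<star> * G u v * y v) =
      of_real (r * qnorm2 (y a)) + (y a)\<^sup>\<star> * s + s\<^sup>\<star> * y a + (\<Sum>u\<in>J. \<Sum>v\<in>J. (x u)\<^sup>\<star> * G u v * x v)"
    using sesquilinear_insert[OF assms(1-4), of y] by (simp add: yx s_def cong: sum.cong)
  also have "of_real (r * qnorm2 (y a)) = (1 / r) *\<^sub>R (s\<^sup>\<star> * s)"
    using assms(5) by (simp add: y_def qnorm2_minus qnorm2_scaleR star_mult_self_of_real of_real_def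
        power2_eq_square)
  also have "(1 / r) *\<^sub>R (s\<^sup>\<star> * s) + (y a)\<^sup>\<star> * s + s\<^sup>\<star> * y a = - ((1 / r) *\<^sub>R (s\<^sup>\<star> * s))"
    by (simp add: y_def star_minus star_scaleR)
  also have "- ((1 / r) *\<^sub>R (s\<^sup>\<star> * s)) + (\<Sum>u\<in>J. \<Sum>v\<in>J. (x u)\<^sup>\<star> * G u v * x v) =
      (\<Sum>u\<in>J. \<Sum>v\<in>J. (x u)\<^sup>\<star> * (G u v - (1 / r) *\<^sub>R (G u a * G a v)) * x v)"
    by (simp add: ss algebra_simps sum_subtractf scaleR_sum_right)
  finally show "\<exists>r'\<ge>0. (\<Sum>u\<in>J. \<Sum>v\<in>J. (x u)\<^sup>\<star> * (G u v - (1 / r) *\<^sub>R (G u a * G a v)) * x v) = of_real r'"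
    using psdD(2)[OF assms(3), of y] by simp
qed

text \<open>Each index splits off a rank-one term b^* b, leaving a matrix supported on the remaining
  indices. Carrying reality through the same induction serves both versions of the theorem.\<close>

lemma psd_factorization:
  assumes "finite I" "psd I G"
  shows "\<exists>cs. (\<forall>u\<in>I. \<forall>v\<in>I. G u v = (\<Sum>c\<leftarrow>cs. (c u)\<^sup>\<star> * c v)) \<and>
    ((\<forall>u\<in>I. \<forall>v\<in>I. G u v \<in> \<real>) \<longrightarrow> (\<forall>c\<in>set cs. \<forall>u\<in>I. c u \<in> \<real>))"
  using assms
proof (induction I arbitrary: G rule: finite_induct)
  case (insert a J)
  have fin: "finite (insert a J)" using insert.hyps by simp
  obtain r where r: "r \<ge> 0" "G a a = of_real r" using psd_diag[OF insert.prems _ fin] by blast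
  \<comment> \<open>For r = 0 division yields 1 / r = 0, so \<open>H\<close> is \<open>G\<close> and
    \<open>b\<close> vanishes; row and column \<open>a\<close> of \<open>G\<close> are then zero by
    \<open>psd_zero_diag\<close>. For r > 0 the subtraction clears them.\<close>
  define H where "H u v = G u v - (1 / r) *\<^sub>R (G u a * G a v)" for u v
  define b where "b u = (1 / sqrt r) *\<^sub>R G a u" for u
  have herm: "(G a u)\<^sup>\<star> = G u a" if "u \<in> insert a J" for u
    using psdD(1)[OF insert.prems] that by simp
  have b: "(b u)\<^sup>\<star> * b v = (1 / r) *\<^sub>R (G u a * G a v)" if "u \<in> insert a J" for u v
    using herm[OF that] r(1) by (simp add: b_def star_scaleR)
  have row: "H a v = 0" "H v a = 0" if "v \<in> insert a J" for v
  proof -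
    have "G a v = 0" if "r = 0"
      using psd_zero_diag[OF insert.prems _ \<open>v \<in> insert a J\<close> fin] r(2) that by simp
    then show "H a v = 0"
      using r(2) by (cases "r = 0") (auto simp: H_def of_real_def)
    then have "(H a v)\<^sup>\<star> = 0" by (simp add: star_zero)
    then show "H v a = 0"
      by (simp add: H_def star_diff star_scaleR star_mult herm[OF that] herm)
  qed
  have "psd J H"
  proof (cases "r = 0")
    case True
    then have "H = G" by (simp add: H_def fun_eq_iff)
    then show ?thesis using psd_subset[OF insert.prems _ fin] by auto
  next
    case False
    then show ?thesis
      using psd_schur_complement[OF insert.hyps insert.prems r(2)] r(1) unfolding H_def by auto
  qed
  from insert.IH[OF this] obtain cs where
    cs: "\<And>u v. u \<in> J \<Longrightarrow> v \<in> J \<Longrightarrow> H u v = (\<Sum>c\<leftarrow>cs. (c u)\<^sup>\<star> * c v)"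
    and cs_real: "(\<forall>u\<in>J. \<forall>v\<in>J. H u v \<in> \<real>) \<Longrightarrow> (\<forall>c\<in>set cs. \<forall>u\<in>J. c u \<in> \<real>)" by blast
  \<comment> \<open>The induction hypothesis says nothing about the vectors at \<open>a\<close>;
    setting them to 0 there leaves row and column \<open>a\<close> to \<open>b\<close>
    alone.\<close>
  define cs' where "cs' = b # map (\<lambda>c. c(a := 0)) cs"
  have "G u v = (\<Sum>c\<leftarrow>cs'. (c u)\<^sup>\<star> * c v)" if uv: "u \<in> insert a J" "v \<in> insert a J" for u v
  proof -
    have "(\<Sum>c\<leftarrow>map (\<lambda>c. c(a := 0)) cs. (c u)\<^sup>\<star> * c v) = H u v"
      using uv row cs[of u v] by (cases "u = a"; cases "v = a") (simp_all add: o_def star_zero)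
    then show ?thesis by (simp add: cs'_def b[OF uv(1)] H_def)
  qed
  moreover have "\<forall>c\<in>set cs'. \<forall>u\<in>insert a J. c u \<in> \<real>"
    if real: "\<forall>u\<in>insert a J. \<forall>v\<in>insert a J. G u v \<in> \<real>"
  proof -
    have "H u v \<in> \<real>" if "u \<in> J" "v \<in> J" for u v
      unfolding H_def scaleR_conv_of_real
      using real that by (intro Reals_diff Reals_mult Reals_of_real) auto
    moreover have "b u \<in> \<real>" if "u \<in> insert a J" for u
      unfolding b_def scaleR_conv_of_real
      using real that by (intro Reals_mult Reals_of_real) auto
    ultimately show ?thesis
      using cs_real by (auto simp: cs'_def)
  qed
  ultimately show ?case
    by (intro exI[of _ cs']) simp
qed simp


section \<open>Left-coefficient polynomials\<close>

lemma const_hom: "const (a + b) = const a + const b" "const (a * b) = const a * const b" "const 0 = 0"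
  by (simp_all add: const_def fp_left_hom)

text \<open>Zero coefficients are allowed on \<open>A\<close>, so that several left-coefficient
  polynomials can share one index set.\<close>

definition word_comb :: "'n word set \<Rightarrow> ('n word \<Rightarrow> quat) \<Rightarrow> 'n qpoly" where
  "word_comb A c = (\<Sum>u\<in>A. const (c u) * mon u)"

lemma left_poly_eq_word_comb:
  assumes "finite A" "Poly_Mapping.keys c \<subseteq> A"
  shows "left_poly c = word_comb A (Poly_Mapping.lookup c)"
  unfolding left_poly_def word_comb_def
  by (rule sum.mono_neutral_left) (use assms in \<open>auto simp: const_hom in_keys_iff\<close>)

lemma word_comb_left_polys:
  assumes "finite A"
  shows "word_comb A c \<in> left_polys"
proof -
  define f where "f = (\<Sum>u\<in>A. Poly_Mapping.single u (c u))"
  have f: "Poly_Mapping.lookup f u = (if u \<in> A then c u else 0)" for u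
    using assms by (simp add: f_def lookup_sum lookup_single when_def)
  have "left_poly f = word_comb A (Poly_Mapping.lookup f)"
    using assms by (intro left_poly_eq_word_comb) (auto simp: in_keys_iff f split: if_splits)
  also have "\<dots> = word_comb A c" by (simp add: word_comb_def f)
  finally show ?thesis by (metis left_polys_def rangeI)
qed

lemma real_polys_add: "x \<in> real_polys \<Longrightarrow> y \<in> real_polys \<Longrightarrow> x + y \<in> real_polys"
  by (auto simp: real_polys_def simp flip: fp_right_hom)

lemma real_polys_sum: "(\<And>i. i \<in> A \<Longrightarrow> f i \<in> real_polys) \<Longrightarrow> (\<Sum>i\<in>A. f i) \<in> real_polys"
  by (induction A rule: infinite_finite_induct)
    (auto simp: real_polys_add, auto simp: real_polys_def simp flip: fp_right_hom(3))

lemma real_polys_mult: "x \<in> real_polys \<Longrightarrow> y \<in> real_polys \<Longrightarrow> x * y \<in> real_polys"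
  by (auto simp: real_polys_def simp flip: fp_right_hom)

lemma mon_real_polys: "mon w \<in> real_polys"
  by (simp add: mon_def real_polys_def)

lemma const_real_polys: "c \<in> \<real> \<Longrightarrow> const c \<in> real_polys"
  by (auto simp: const_def real_polys_def fp_left_of_real elim!: Reals_cases)

lemma word_comb_real_polys:
  assumes "\<forall>u\<in>A. c u \<in> \<real>"
  shows "word_comb A c \<in> real_polys"
  unfolding word_comb_def
  by (intro real_polys_sum real_polys_mult mon_real_polys const_real_polys) (use assms in auto)

lemma real_polys_left_poly:
  assumes "f \<in> real_polys"
  obtains c where "f = left_poly c" "\<And>w. Poly_Mapping.lookup c w \<in> \<real>"
proof -
  obtain r where r: "f = fp_right r" using assms by (auto simp: real_polys_def)
  let ?c = "Poly_Mapping.map of_real r :: 'a word \<Rightarrow>\<^sub>0 quat"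
  have "Poly_Mapping.keys ?c = Poly_Mapping.keys r"
    by (auto simp: in_keys_iff lookup_map_of_real)
  then have "f = left_poly ?c"
    by (simp add: r fp_right_eq_sum left_poly_def lookup_map_of_real)
  then show ?thesis using that by (simp add: lookup_map_of_real)
qed

text \<open>Starring moves the coefficients to the right, so the two constants meet in the middle
  and merge into one entry of a rank-one Gram matrix.\<close>

lemma star_word_comb_mult:
  "(word_comb A c)\<^sup>\<star> * word_comb A c = (\<Sum>u\<in>A. \<Sum>v\<in>A. mon (u\<^sup>\<star>) * const ((c u)\<^sup>\<star> * c v) * mon v)"
  by (simp add: word_comb_def star_sum star_mult star_mon star_const sum_product const_hom mult.assoc)

section \<open>Gram representations and their real parts\<close>

lemma gram_of_vectors:
  "gram d (\<lambda>u v. \<Sum>c\<leftarrow>cs. (c u)\<^sup>\<star> * c v) = (\<Sum>c\<leftarrow>cs. (word_comb (words_upto d) c)\<^sup>\<star> * word_comb (words_upto d) c)"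
proof (induction cs)
  case Nil
  show ?case by (simp add: gram_def const_hom)
next
  case (Cons c cs)
  have "gram d (\<lambda>u v. \<Sum>c\<leftarrow>c # cs. (c u)\<^sup>\<star> * c v) =
      gram d (\<lambda>u v. (c u)\<^sup>\<star> * c v) + gram d (\<lambda>u v. \<Sum>c\<leftarrow>cs. (c u)\<^sup>\<star> * c v)"
    by (simp add: gram_def const_hom(1) distrib_left distrib_right sum.distrib)
  then show ?case using Cons by (simp add: star_word_comb_mult gram_def)
qed

lemma gram_cong:
  assumes "\<And>u v. u \<in> words_upto d \<Longrightarrow> v \<in> words_upto d \<Longrightarrow> G u v = H u v"
  shows "gram d G = gram d H"
  unfolding gram_def by (intro sum.cong refl) (simp add: assms)

text \<open>Both sides are real polynomials, hence determined by their values under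
  \<open>re_coeff\<close>, and \<open>re_coeff\<close> of a Gram expression sees only the real parts
  of the entries.\<close>

lemma gram_real_part:
  fixes p :: "'n::finite qpoly"
  assumes "p \<in> real_polys" "p = gram d G"
  shows "p = gram d (\<lambda>u v. of_real (qRe (G u v)))"
proof -
  let ?H = "\<lambda>u v. of_real (qRe (G u v)) :: quat"
  have "gram d ?H \<in> real_polys"
    unfolding gram_def
    by (intro real_polys_sum real_polys_mult mon_real_polys const_real_polys Reals_of_real)
  then obtain r s where rs: "p = fp_right r" "gram d ?H = fp_right s"
    using assms(1) by (auto simp: real_polys_def)
  have "re_coeff p w = re_coeff (gram d ?H) w" for w
    unfolding assms(2) gram_def re_coeff_sum re_coeff_monomial qRe_of_real ..
  then have "r = s"
    unfolding rs re_coeff_fp_right by (rule poly_mapping_eqI)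
  then show ?thesis using rs by simp
qed


section \<open>The degree bound\<close>

text \<open>Parallelogram law: |A - B|^2 = 2 |A|^2 + 2 |B|^2 - 4 |C|^2 <= 0 for the multiplicity
  vectors, so A = B. Casting to \<open>int\<close> keeps the differences from being
  truncated.\<close>

lemma content_square_sum_unique:
  fixes A B C :: "'n::finite multiset"
  defines "N \<equiv> \<lambda>A :: 'n multiset. \<Sum>i\<in>UNIV. (int (count A i))\<^sup>2"
  assumes "A + B = C + C" "N A \<le> N C" "N B \<le> N C"
  shows "A = C" "B = C"
proof -
  have AB: "int (count A i) + int (count B i) = 2 * int (count C i)" for i
    using arg_cong[OF assms(2), of "\<lambda>M. count M i"] by simp
  have "(\<Sum>i\<in>UNIV. (int (count A i) - int (count B i))\<^sup>2) =
      (\<Sum>i\<in>UNIV. 2 * (int (count A i))\<^sup>2 + 2 * (int (count B i))\<^sup>2 - 4 * (int (count C i))\<^sup>2)"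
  proof (rule sum.cong[OF refl])
    fix i
    have "(2 * int (count C i))\<^sup>2 = (int (count A i) + int (count B i))\<^sup>2" by (simp only: AB)
    then show "(int (count A i) - int (count B i))\<^sup>2 =
        2 * (int (count A i))\<^sup>2 + 2 * (int (count B i))\<^sup>2 - 4 * (int (count C i))\<^sup>2"
      by (simp add: power2_eq_square algebra_simps)
  qed
  also have "\<dots> = 2 * N A + 2 * N B - 4 * N C"
    by (simp add: N_def sum.distrib sum_subtractf sum_distrib_left)
  also have "\<dots> \<le> 0" using assms by linarith
  finally have "(\<Sum>i\<in>UNIV. (int (count A i) - int (count B i))\<^sup>2) = 0"
    by (meson antisym sum_nonneg zero_le_power2)
  then have "int (count A i) = int (count B i)" for i
    by (subst (asm) sum_nonneg_eq_0_iff) auto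
  then have "count A i = count C i \<and> count B i = count C i" for i
    using AB[of i] by (smt (verit) of_nat_eq_iff)
  then show "A = C" "B = C" by (auto intro: multiset_eqI)
qed

text \<open>The minimum in \<open>deg\<close> is attained because some bound exists: the sum of all
  monomial lengths in any one family is a crude one.\<close>

lemma deg_obtain:
  assumes "p \<in> middle_polys"
  obtains c where "p = middle_poly c" "\<And>a b. (a, b) \<in> Poly_Mapping.keys c \<Longrightarrow> wlength a + wlength b \<le> deg p"
proof -
  obtain c where c: "p = middle_poly c" using assms by (auto simp: middle_polys_def)
  have "\<exists>m c. p = middle_poly c \<and> (\<forall>(a, b)\<in>Poly_Mapping.keys c. wlength a + wlength b \<le> m)"
  proof (intro exI conjI, rule c, safe)
    fix a b assume "(a, b) \<in> Poly_Mapping.keys c"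
    then show "wlength a + wlength b \<le> (\<Sum>(a, b)\<in>Poly_Mapping.keys c. wlength a + wlength b)"
      using member_le_sum[of "(a, b)" "Poly_Mapping.keys c" "\<lambda>(a, b). wlength a + wlength b"] by auto
  qed
  from LeastI_ex[OF this] that show ?thesis
    unfolding deg_def by blast
qed

text \<open>Evaluated on a family attaining the degree, no monomial is long enough to multiply out
  to \<open>w\<close>.\<close>

lemma re_coeff_beyond_deg:
  assumes "p \<in> middle_polys" "wlength w > deg p"
  shows "re_coeff p w = 0"
proof -
  obtain c where c: "p = middle_poly c"
      "\<And>a b. (a, b) \<in> Poly_Mapping.keys c \<Longrightarrow> wlength a + wlength b \<le> deg p"
    using deg_obtain[OF assms(1)] by blast
  have "re_coeff p w = (\<Sum>(a, b)\<in>Poly_Mapping.keys c.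
      if a + b = w then qRe (Poly_Mapping.lookup c (a, b)) else 0)"
    by (subst c(1)) (auto simp: middle_poly_def re_coeff_sum re_coeff_monomial intro!: sum.cong)
  also have "\<dots> = 0"
    by (rule sum.neutral) (use c(2) assms(2) in fastforce)
  finally show ?thesis .
qed

text \<open>Length and then norm extremality force both factors of any product equal to u0^* u0 to
  have the content of \<open>u0\<close>; cancellation makes them equal. All words of that content
  have the same square, hence the sum over them.\<close>

lemma re_coeff_star_mult_top:
  fixes A :: "'n::finite word set"
  assumes "finite A" "u0 \<in> A" and len: "\<And>u. u \<in> A \<Longrightarrow> wlength u \<le> wlength u0"
    and sq: "\<And>u. u \<in> A \<Longrightarrow> wlength u = wlength u0 \<Longrightarrow>
      (\<Sum>i\<in>UNIV. (int (count (wcontent u) i))\<^sup>2) \<le> (\<Sum>i\<in>UNIV. (int (count (wcontent u0) i))\<^sup>2)"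
  shows "re_coeff ((word_comb A c)\<^sup>\<star> * word_comb A c) (u0\<^sup>\<star> + u0) =
    (\<Sum>u | u \<in> A \<and> wcontent u = wcontent u0. qnorm2 (c u))"
proof -
  have diag: "u\<^sup>\<star> + v = u0\<^sup>\<star> + u0 \<longleftrightarrow> u = v \<and> wcontent u = wcontent u0" if "u \<in> A" "v \<in> A" for u v
  proof
    assume eq: "u\<^sup>\<star> + v = u0\<^sup>\<star> + u0"
    have "wlength u + wlength v = 2 * wlength u0"
      using arg_cong[OF eq, of wlength] by simp
    then have "wlength u = wlength u0" "wlength v = wlength u0"
      using len[OF that(1)] len[OF that(2)] by linarith+
    then have content: "wcontent u = wcontent u0" "wcontent v = wcontent u0"
      using content_square_sum_unique[of "wcontent u" "wcontent v" "wcontent u0"]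
        sq[OF that(1)] sq[OF that(2)] arg_cong[OF eq, of wcontent] by simp_all
    then have "u\<^sup>\<star> + u = u\<^sup>\<star> + v"
      using eq star_plus_self_cong by metis
    then show "u = v \<and> wcontent u = wcontent u0"
      using content word_add_left_cancel by blast
  next
    assume "u = v \<and> wcontent u = wcontent u0"
    then show "u\<^sup>\<star> + v = u0\<^sup>\<star> + u0" using star_plus_self_cong by metis
  qed
  have "re_coeff ((word_comb A c)\<^sup>\<star> * word_comb A c) (u0\<^sup>\<star> + u0) =
      (\<Sum>u\<in>A. \<Sum>v\<in>A. if u\<^sup>\<star> + v = u0\<^sup>\<star> + u0 then qRe ((c u)\<^sup>\<star> * c v) else 0)"
    by (simp add: star_word_comb_mult re_coeff_sum re_coeff_monomial)
  also have "\<dots> = (\<Sum>u\<in>A. \<Sum>v\<in>A. if v = u then (if wcontent u = wcontent u0 then qnorm2 (c u) else 0) else 0)"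
    by (intro sum.cong refl) (auto simp: diag star_mult_self_of_real)
  also have "\<dots> = (\<Sum>u\<in>A. if wcontent u = wcontent u0 then qnorm2 (c u) else 0)"
    using assms(1) by simp
  also have "\<dots> = (\<Sum>u | u \<in> A \<and> wcontent u = wcontent u0. qnorm2 (c u))"
    using assms(1) by (simp add: sum.inter_filter)
  finally show ?thesis .
qed

lemma sum_of_squares_degree_bound:
  fixes p :: "'n::finite qpoly"
  assumes p: "p \<in> middle_polys" "deg p \<le> 2 * d"
    and sos: "p = (\<Sum>c\<leftarrow>cs. (left_poly c)\<^sup>\<star> * left_poly c)"
    and c: "c \<in> set cs"
  shows "Poly_Mapping.keys c \<subseteq> words_upto d"
proof (rule ccontr)
  assume "\<not> Poly_Mapping.keys c \<subseteq> words_upto d"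
  \<comment> \<open>A common support makes one \<open>u0\<close> extremal for all summands at once,
    so their nonnegative contributions to the same coefficient add up.\<close>
  define A where "A = (\<Union>c\<in>set cs. Poly_Mapping.keys c)"
  have A: "finite A" "\<And>c. c \<in> set cs \<Longrightarrow> Poly_Mapping.keys c \<subseteq> A"
    by (auto simp: A_def)
  obtain u' where "u' \<in> Poly_Mapping.keys c" "u' \<notin> words_upto d"
    using \<open>\<not> _\<close> by blast
  then have u': "u' \<in> A" "wlength u' > d"
    using A(2)[OF c] by (auto simp: words_upto_def)
  define D where "D = Max (wlength ` A)"
  define B where "B = {u \<in> A. wlength u = D}"
  define N where "N u = (\<Sum>i\<in>UNIV. (int (count (wcontent u) i))\<^sup>2)" for u :: "'n word"
  have D: "\<And>u. u \<in> A \<Longrightarrow> wlength u \<le> D" using A(1) by (auto simp: D_def)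
  have "D \<in> wlength ` A" unfolding D_def using A(1) u'(1) by (intro Max_in) auto
  then have B: "finite B" "B \<noteq> {}" using A(1) by (auto simp: B_def)
  then have "Max (N ` B) \<in> N ` B" by (intro Max_in) auto
  then obtain u0 where u0: "u0 \<in> B" "N u0 = Max (N ` B)" by auto
  then have u0A: "u0 \<in> A" "wlength u0 = D" by (auto simp: B_def)
  have sq: "N u \<le> N u0" if "u \<in> A" "wlength u = wlength u0" for u
    unfolding u0(2) using B(1) that u0A by (intro Max_ge) (auto simp: B_def)
  define F where "F c = (\<Sum>u | u \<in> A \<and> wcontent u = wcontent u0. qnorm2 (Poly_Mapping.lookup c u))"
    for c :: "'n word \<Rightarrow>\<^sub>0 quat"
  have "re_coeff ((left_poly c)\<^sup>\<star> * left_poly c) (u0\<^sup>\<star> + u0) = F c" if "c \<in> set cs" for c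
    unfolding left_poly_eq_word_comb[OF A(1) A(2)[OF that]] F_def
    using re_coeff_star_mult_top[OF A(1) u0A(1)] D u0A(2) sq by (simp add: N_def)
  then have "re_coeff p (u0\<^sup>\<star> + u0) = (\<Sum>c\<leftarrow>cs. F c)"
    unfolding sos re_coeff_sum_list by (simp cong: map_cong)
  \<comment> \<open>The word has length 2 D, and D >= \<open>wlength u'\<close> > d puts it beyond
    the degree of \<open>p\<close>.\<close>
  moreover have "re_coeff p (u0\<^sup>\<star> + u0) = 0"
    using p u'(2) D[OF u'(1)] u0A(2) by (intro re_coeff_beyond_deg) auto
  ultimately have "(\<Sum>c\<leftarrow>cs. F c) = 0" by simp
  moreover have F_nonneg: "F c \<ge> 0" for c
    unfolding F_def by (intro sum_nonneg qnorm2_nonneg)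
  ultimately have F0: "F c = 0" if "c \<in> set cs" for c
    using that by (subst (asm) sum_list_nonneg_eq_0_iff) auto
  obtain c' where c': "c' \<in> set cs" "u0 \<in> Poly_Mapping.keys c'"
    using u0A(1) by (auto simp: A_def)
  have "qnorm2 (Poly_Mapping.lookup c' u0) = 0"
    using F0[OF c'(1)] A(1) u0A(1) unfolding F_def
    by (subst (asm) sum_nonneg_eq_0_iff) (auto simp: qnorm2_nonneg)
  then show False using c'(2) by (simp add: qnorm2_eq_0_iff in_keys_iff)
qed

section \<open>Passage between sums of squares and Gram matrices\<close>

lemma sum_of_squares_imp_gram:
  fixes p :: "'n::finite qpoly"
  assumes "p \<in> middle_polys" "deg p \<le> 2 * d" "p = (\<Sum>c\<leftarrow>cs. (left_poly c)\<^sup>\<star> * left_poly c)"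
  shows "p = gram d (\<lambda>u v. \<Sum>c\<leftarrow>map Poly_Mapping.lookup cs. (c u)\<^sup>\<star> * c v)"
proof -
  have "left_poly c = word_comb (words_upto d) (Poly_Mapping.lookup c)" if "c \<in> set cs" for c
    by (rule left_poly_eq_word_comb[OF finite_words_upto sum_of_squares_degree_bound[OF assms that]])
  then show ?thesis
    unfolding gram_of_vectors by (subst assms(3)) (simp add: o_def cong: map_cong)
qed

lemma left_polys_list:
  assumes "set ps \<subseteq> left_polys"
  obtains cs where "ps = map left_poly cs"
  using assms by (metis ex_map_conv image_iff left_polys_def subsetD)

lemma real_polys_list:
  assumes "set ps \<subseteq> real_polys"
  obtains cs where "ps = map left_poly cs" "\<And>c w. c \<in> set cs \<Longrightarrow> Poly_Mapping.lookup c w \<in> \<real>"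
proof -
  have "\<exists>cs. ps = map left_poly cs \<and> (\<forall>c\<in>set cs. \<forall>w. Poly_Mapping.lookup c w \<in> \<real>)"
    using assms
  proof (induction ps)
    case (Cons f ps)
    then obtain cs where "ps = map left_poly cs" "\<forall>c\<in>set cs. \<forall>w. Poly_Mapping.lookup c w \<in> \<real>" by auto
    moreover obtain c where "f = left_poly c" "\<And>w. Poly_Mapping.lookup c w \<in> \<real>"
      using real_polys_left_poly[of f] Cons.prems by auto
    ultimately show ?case by (intro exI[of _ "c # cs"]) auto
  qed simp
  then show ?thesis using that by blast
qed

lemma sum_list_Reals: "(\<And>x. x \<in> set xs \<Longrightarrow> f x \<in> \<real>) \<Longrightarrow> (\<Sum>x\<leftarrow>xs. f x) \<in> \<real>"
  by (induction xs) auto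

lemma star_Reals: "x \<in> \<real> \<Longrightarrow> (x :: 'a::real_star_algebra)\<^sup>\<star> \<in> \<real>"
  by (auto elim!: Reals_cases simp: star_of_real)

lemma qsos_imp_gram:
  fixes p :: "'n::finite qpoly"
  assumes "p \<in> middle_polys" "deg p \<le> 2 * d" "qsos p"
  shows "\<exists>G. psd (words_upto d) G \<and> (p \<in> Sym real_polys \<longrightarrow> (\<forall>u v. G u v \<in> \<real>)) \<and> p = gram d G"
proof -
  obtain ps where ps: "set ps \<subseteq> (if p \<in> Sym real_polys then real_polys else left_polys)"
      "p = (\<Sum>f\<leftarrow>ps. f\<^sup>\<star> * f)"
    using assms(3) unfolding qsos_def by blast
  obtain cs where cs: "ps = map left_poly cs"
    and real: "p \<in> Sym real_polys \<Longrightarrow> \<forall>c\<in>set cs. \<forall>w. Poly_Mapping.lookup c w \<in> \<real>"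
  proof (cases "p \<in> Sym real_polys")
    case True
    with ps(1) have "set ps \<subseteq> real_polys" by simp
    then obtain cs where "ps = map left_poly cs" "\<And>c w. c \<in> set cs \<Longrightarrow> Poly_Mapping.lookup c w \<in> \<real>"
      using real_polys_list by blast
    then show ?thesis by (intro that) auto
  next
    case False
    with ps(1) have "set ps \<subseteq> left_polys" by simp
    then obtain cs where "ps = map left_poly cs"
      using left_polys_list by blast
    with False show ?thesis by (intro that) auto
  qed
  let ?G = "\<lambda>u v. \<Sum>c\<leftarrow>map Poly_Mapping.lookup cs. (c u)\<^sup>\<star> * c v"
  have "p = gram d ?G"
    by (rule sum_of_squares_imp_gram[OF assms(1,2)]) (simp add: ps(2) cs o_def)
  moreover have "psd (words_upto d) ?G" by (rule psd_gram_of_vectors)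
  moreover have "?G u v \<in> \<real>" if "p \<in> Sym real_polys" for u v
    using real[OF that] by (intro sum_list_Reals Reals_mult star_Reals) auto
  ultimately show ?thesis by blast
qed

lemma gram_imp_qsos:
  fixes p :: "'n::finite qpoly"
  assumes "psd (words_upto d) G" "p = gram d G"
  shows "qsos p"
proof -
  \<comment> \<open>For real \<open>p\<close>, \<open>qsos\<close> demands real summands even when
    \<open>G\<close> is quaternionic, so the real part of \<open>G\<close> is taken before
    factoring.\<close>
  define H where "H = (if p \<in> Sym real_polys then (\<lambda>u v. of_real (qRe (G u v))) else G)"
  have H: "psd (words_upto d) H" "p = gram d H"
    using assms psd_real_part gram_real_part[of p d G] by (auto simp: H_def Sym_def)
  obtain cs where cs: "\<And>u v. u \<in> words_upto d \<Longrightarrow> v \<in> words_upto d \<Longrightarrow> H u v = (\<Sum>c\<leftarrow>cs. (c u)\<^sup>\<star> * c v)"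
    and real: "(\<forall>u\<in>words_upto d. \<forall>v\<in>words_upto d. H u v \<in> \<real>) \<Longrightarrow> \<forall>c\<in>set cs. \<forall>u\<in>words_upto d. c u \<in> \<real>"
    using psd_factorization[OF finite_words_upto H(1)] by blast
  let ?ps = "map (word_comb (words_upto d)) cs"
  have "p = (\<Sum>f\<leftarrow>?ps. f\<^sup>\<star> * f)"
    using H(2) gram_cong[of d H, OF cs] by (simp add: gram_of_vectors o_def)
  moreover have "set ?ps \<subseteq> (if p \<in> Sym real_polys then real_polys else left_polys)"
  proof (cases "p \<in> Sym real_polys")
    case True
    then have "\<forall>c\<in>set cs. \<forall>u\<in>words_upto d. c u \<in> \<real>"
      by (intro real) (simp add: H_def)
    then show ?thesis using True by (auto intro!: word_comb_real_polys)
  qed (auto intro: word_comb_left_polys)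
  ultimately show ?thesis unfolding qsos_def by (intro exI conjI)
qed

theorem lemma4p2:
  fixes p :: "'n::finite qpoly" and d :: nat
  assumes "p \<in> Sym middle_polys" and "deg p = 2 * d"
  shows "(qsos p \<longleftrightarrow> (\<exists>G. psd (words_upto d) G \<and> p = gram d G)) \<and>
    (p \<in> Sym real_polys \<longrightarrow>
      (qsos p \<longleftrightarrow> (\<exists>G. psd (words_upto d) G \<and> (\<forall>u\<in>words_upto d. \<forall>v\<in>words_upto d. G u v \<in> \<real>) \<and>
        p = gram d G)))"
proof -
  have "p \<in> middle_polys" "deg p \<le> 2 * d"
    using assms by (auto simp: Sym_def)
  note forward = qsos_imp_gram[OF this]
  have "qsos p \<longleftrightarrow> (\<exists>G. psd (words_upto d) G \<and> p = gram d G)"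
    using forward gram_imp_qsos by metis
  moreover have "qsos p \<longleftrightarrow> (\<exists>G. psd (words_upto d) G \<and>
      (\<forall>u\<in>words_upto d. \<forall>v\<in>words_upto d. G u v \<in> \<real>) \<and> p = gram d G)" if "p \<in> Sym real_polys"
    using forward that gram_imp_qsos[of d _ p] by blast
  ultimately show ?thesis by blast
qed

end
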